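(* Let $\lambda>0$ and $E_\lambda(x)=C_\lambda(x)-S_\lambda(x)$. Then $E_\lambda(x_n)=O(\lambda_n^{-1})$ as $n\to-\infty$. In fact $$\lim_{n\to-\infty}\lambda_nE_\lambda(x_n)=-1$$ and $$\lim_{n\to-\infty}\big(C_\lambda(x_n)^2-S_\lambda(x_n)^2\big)=\frac12 .$$ More precisely, as $n\to-\infty$, $$E_\lambda(x_n)=\frac{2}{2-\lambda_n}+\frac{\lambda_n}{2-\lambda_{n-1}}+\frac{4\lambda_n}{(2-\lambda_n)(2-\lambda_{n-1})}+O(\lambda_n^{-3}).$$
   Context: Let $q_0,q_1,q_2$ be the vertices of an equilateral triangle in the plane (indices mod 3), $F_i(x)=\frac12(x+q_i)$, and let $SG$ (Sierpinski gasket) be the unique nonempty compact set with $SG=\bigcup_{i=0}^2F_i(SG)$. For a word $w=(w_1,\dots,w_m)\in\{0,1,2\}^m$, $|w|=m$, put $F_w=F_{w_1}\circ\cdots\circ F_{w_m}$. $V_0=\{q_0,q_1,q_2\}$, $V_m=\bigcup_iF_i(V_{m-1})$, $V_*=\bigcup_mV_m$; for distinct $x,y\in V_m$, $x\sim_my$ means $x,y$ lie in a common set $F_w(SG)$ with $|w|=m$. Laplacian: $u\in\mathrm{dom}\,\Delta$ with $\Delta u=f$ means that $u,f$ are continuous on $SG$ and $\frac32 5^m\sum_{y\sim_mx}(u(y)-u(x))\to f(x)$ as $m\to\infty$, uniformly for $x\in V_*\setminus V_0$. Normal derivative: $\partial_nu(q_0)=\lim_{m\to\infty}(5/3)^m\big(2u(q_0)-u(F_0^mq_1)-u(F_0^mq_2)\big)$.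 Infinite blow-up: $SG_\infty=\bigcup_{n\ge1}F_0^{-n}(SG)$. On $SG_\infty$, $\Delta u=f$ means that for each $n\ge0$, $\Delta(u\circ F_0^{-n})=5^{n}f\circ F_0^{-n}$ on $SG$. Let $\rho_0$ be the reflection fixing $q_0$ and interchanging $q_1,q_2$ (acting on $SG_\infty$). $x_n=F_0^nq_1$ for $n\in\mathbb Z$. For $\lambda>0$, $\{\lambda_n\}_{n\in\mathbb Z}$ is the unique sequence of negative numbers with $\lambda_{n-1}=\lambda_n(5-\lambda_n)$ for all $n$ and $-\lambda=\lim_{n\to\infty}\frac32 5^n\lambda_n$ (so $\lambda_n\to-\infty$ as $n\to-\infty$). $C_\lambda,S_\lambda$ are the solutions on $SG_\infty$ of $-\Delta u=-\lambda u$, even with respect to $\rho_0$, with $C_\lambda(q_0)=1$, $\partial_nC_\lambda(q_0)=0$, and $S_\lambda(q_0)=0$, $\partial_nS_\lambda(q_0)=a_\lambda$, where the constant $a_\lambda$ is chosen so that $S_\lambda(x_n)=-\frac{\lambda_n}{4}\prod_{k=0}^\infty\big(1+\frac{4}{2-\lambda_{n-k}}\big)$ for all $n\in\mathbb Z$. *)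

theory Defs
  imports "HOL-Analysis.Analysis" "HOL-Library.Landau_Symbols"
begin

definition equilateral :: "(nat \<Rightarrow> real^2) \<Rightarrow> bool" where
  "equilateral q \<longleftrightarrow>
     (\<exists>s>0. dist (q 0) (q 1) = s \<and> dist (q 1) (q 2) = s \<and> dist (q 2) (q 0) = s)"

definition F :: "(nat \<Rightarrow> real^2) \<Rightarrow> nat \<Rightarrow> real^2 \<Rightarrow> real^2" where
  "F q i x = (1/2) *\<^sub>R (x + q i)"

definition SG :: "(nat \<Rightarrow> real^2) \<Rightarrow> (real^2) set" where
  "SG q = (THE K. compact K \<and> K \<noteq> {} \<and> K = (\<Union>i\<in>{0,1,2}. F q i ` K))"

fun Fword :: "(nat \<Rightarrow> real^2) \<Rightarrow> nat list \<Rightarrow> real^2 \<Rightarrow> real^2" where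
  "Fword q [] = id"
| "Fword q (i # w) = F q i \<circ> Fword q w"

definition words :: "nat \<Rightarrow> nat list set" where
  "words m = {w. set w \<subseteq> {0,1,2} \<and> length w = m}"

fun V :: "(nat \<Rightarrow> real^2) \<Rightarrow> nat \<Rightarrow> (real^2) set" where
  "V q 0 = {q 0, q 1, q 2}"
| "V q (Suc m) = (\<Union>i\<in>{0,1,2}. F q i ` V q m)"

definition adj :: "(nat \<Rightarrow> real^2) \<Rightarrow> nat \<Rightarrow> real^2 \<Rightarrow> real^2 \<Rightarrow> bool" where
  "adj q m x y \<longleftrightarrow> x \<in> V q m \<and> y \<in> V q m \<and> x \<noteq> y \<and>
     (\<exists>w\<in>words m. x \<in> Fword q w ` SG q \<and> y \<in> Fword q w ` SG q)"

definition graph_laplacian ::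
    "(nat \<Rightarrow> real^2) \<Rightarrow> nat \<Rightarrow> (real^2 \<Rightarrow> real) \<Rightarrow> real^2 \<Rightarrow> real" where
  "graph_laplacian q m u x = (\<Sum>y | adj q m x y. u y - u x)"

text \<open>
  The graph Laplacian of level \<open>m\<close> only makes sense at points of \<open>V q m\<close>.
  Uniform convergence on the union of all \<open>V q m\<close> minus \<open>V q 0\<close> therefore means that, at
  level \<open>m\<close>, the error is uniformly small over the points of \<open>V q m\<close> outside \<open>V q 0\<close>.
  Functions on the gasket and on its blow-up are functions on the plane whose
  values elsewhere are irrelevant.
\<close>

definition has_laplacian ::
    "(nat \<Rightarrow> real^2) \<Rightarrow> (real^2 \<Rightarrow> real) \<Rightarrow> (real^2 \<Rightarrow> real) \<Rightarrow> bool" where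
  "has_laplacian q u f \<longleftrightarrow> continuous_on (SG q) u \<and> continuous_on (SG q) f \<and>
     (\<forall>e>0. \<exists>N. \<forall>m\<ge>N. \<forall>x \<in> V q m - V q 0.
        \<bar>3/2 * 5^m * graph_laplacian q m u x - f x\<bar> < e)"

definition has_normal_deriv ::
    "(nat \<Rightarrow> real^2) \<Rightarrow> (real^2 \<Rightarrow> real) \<Rightarrow> real \<Rightarrow> bool" where
  "has_normal_deriv q u d \<longleftrightarrow>
     (\<lambda>m. (5/3)^m * (2 * u (q 0) - u ((F q 0 ^^ m) (q 1)) - u ((F q 0 ^^ m) (q 2))))
       \<longlonglongrightarrow> d"

definition F0pow :: "(nat \<Rightarrow> real^2) \<Rightarrow> int \<Rightarrow> real^2 \<Rightarrow> real^2" where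
  "F0pow q n = (if n \<ge> 0 then F q 0 ^^ nat n else inv (F q 0) ^^ nat (- n))"

definition SGinf :: "(nat \<Rightarrow> real^2) \<Rightarrow> (real^2) set" where
  "SGinf q = (\<Union>n\<in>{1::nat..}. F0pow q (- int n) ` SG q)"

definition has_laplacian_inf ::
    "(nat \<Rightarrow> real^2) \<Rightarrow> (real^2 \<Rightarrow> real) \<Rightarrow> (real^2 \<Rightarrow> real) \<Rightarrow> bool" where
  "has_laplacian_inf q u f \<longleftrightarrow>
     (\<forall>n::nat. has_laplacian q (u \<circ> F0pow q (- int n)) (\<lambda>x. 5^n * f (F0pow q (- int n) x)))"

text \<open>Solutions of \<open>- \<Delta> u = - lam u\<close> on the blow-up.\<close>

definition solves_inf :: "(nat \<Rightarrow> real^2) \<Rightarrow> real \<Rightarrow> (real^2 \<Rightarrow> real) \<Rightarrow> bool" where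
  "solves_inf q lam u \<longleftrightarrow>
     (\<exists>f. has_laplacian_inf q u f \<and> (\<forall>x\<in>SGinf q. - f x = - lam * u x))"

text \<open>Reflection in the line through \<open>q 0\<close> perpendicular to the side \<open>q 1\<close>, \<open>q 2\<close>.\<close>

definition rho0 :: "(nat \<Rightarrow> real^2) \<Rightarrow> real^2 \<Rightarrow> real^2" where
  "rho0 q x = x - (2 * ((x - q 0) \<bullet> (q 2 - q 1)) / (norm (q 2 - q 1))\<^sup>2) *\<^sub>R (q 2 - q 1)"

definition even_rho0 :: "(nat \<Rightarrow> real^2) \<Rightarrow> (real^2 \<Rightarrow> real) \<Rightarrow> bool" where
  "even_rho0 q u \<longleftrightarrow> (\<forall>x\<in>SGinf q. u (rho0 q x) = u x)"

definition xpt :: "(nat \<Rightarrow> real^2) \<Rightarrow> int \<Rightarrow> real^2" where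
  "xpt q n = F0pow q n (q 1)"

definition decimation_seq :: "real \<Rightarrow> (int \<Rightarrow> real) \<Rightarrow> bool" where
  "decimation_seq lam l \<longleftrightarrow> (\<forall>n. l n < 0) \<and> (\<forall>n. l (n - 1) = l n * (5 - l n)) \<and>
     ((\<lambda>n. 3/2 * 5^n * l (int n)) \<longlongrightarrow> - lam) sequentially"

lemma rho0_fixes: "rho0 q (q 0) = q 0"
  by (simp add: rho0_def)

lemma rho0_swaps:
  assumes "equilateral q"
  shows "rho0 q (q 1) = q 2" "rho0 q (q 2) = q 1"
proof -
  let ?a = "q 1 - q 0" and ?b = "q 2 - q 0"
  obtain s where s0: "s > 0" "dist (q 0) (q 1) = s" "dist (q 1) (q 2) = s" "dist (q 2) (q 0) = s"
    using assms unfolding equilateral_def by blast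
  have s: "s > 0" "norm ?a = s" "norm (?b - ?a) = s" "norm ?b = s"
    using s0 by (simp_all add: dist_norm norm_minus_commute)
  then have "?a \<bullet> ?a = s\<^sup>2" "?b \<bullet> ?b = s\<^sup>2" "(?b - ?a) \<bullet> (?b - ?a) = s\<^sup>2"
    by (metis power2_norm_eq_inner)+
  then have "?a \<bullet> (?b - ?a) = - (s\<^sup>2) / 2" "?b \<bullet> (?b - ?a) = s\<^sup>2 / 2"
    by (auto simp: inner_diff_left inner_diff_right inner_commute)
  then have "2 * (?a \<bullet> (q 2 - q 1)) / (norm (q 2 - q 1))\<^sup>2 = -1"
    "2 * (?b \<bullet> (q 2 - q 1)) / (norm (q 2 - q 1))\<^sup>2 = 1"
    using s by (simp_all add: field_simps)
  then show "rho0 q (q 1) = q 2" "rho0 q (q 2) = q 1"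
    by (simp_all only: rho0_def) simp_all
qed

end

theory Submission
  imports Defs "HOL-Real_Asymp.Real_Asymp"
begin

text \<open>
  Write \<open>\<mu> n = - l n > 0\<close>, so that \<open>\<mu> (n - 1) = \<mu> n * (5 + \<mu> n)\<close> and \<open>\<mu> n\<close> grows doubly
  exponentially as \<open>n \<rightarrow> -\<infinity>\<close>. The theorem rests on the closed form \<open>C (x_n) = 1 + \<mu> n / 4\<close>
  (lemma \<open>cosine_at_xpt\<close>). The prescribed values of \<open>S\<close> are \<open>S (x_n) = \<mu> n / 4 * P n\<close>, where
  \<open>P n\<close> is the infinite product. Hence \<open>E (x_n) = 1 + \<mu> n / 4 * (1 - P n)\<close>, and the claimed
  expansion is what remains when only the first two factors of \<open>P n\<close> are kept: the third
  factor differs from \<open>1\<close> by about \<open>4 / \<mu> (n - 2)\<close>, and \<open>\<mu> (n - 2)\<close> exceeds the fourth power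
  of \<open>\<mu> n\<close>. This gives the error \<open>9 / (\<mu> n)^3\<close> of lemma \<open>difference_remainder\<close>, valid for every
  \<open>n\<close>; the other limits follow from it, using \<open>C^2 - S^2 = E (2 C - E)\<close>.

  The closed form comes from spectral decimation: a solution of \<open>\<Delta> u = lam u\<close> satisfies the exact
  equation \<open>\<Delta>_m u = - l m * u\<close> on the graph of every level \<open>m\<close> (lemma \<open>decimation\<close>). By definition
  of the Laplacian this equation holds at a fine level \<open>m\<close> up to a uniform error that is
  \<open>o (5^(-m))\<close>, that is, \<open>o (\<bar>l m\<bar>)\<close>. Eliminating the vertices that are new at level \<open>m + 1\<close> turns
  an approximate equation at level \<open>m + 1\<close> into one at level \<open>m\<close>, and the error grows by a factor
  of at most \<open>5 - l (m + 1)\<close> (lemma \<open>decimation_step\<close>). This is exactly the ratio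
  \<open>l m / l (m + 1)\<close>, so the error relative to \<open>\<bar>l m\<bar>\<close> does not grow on the way down; being
  arbitrarily small at fine levels, it vanishes at every level.

  On a cell with corner \<open>q 0\<close>, subdivided once, the exact equations together with evenness give a
  two-term recursion for \<open>u (x_n)\<close> (lemma \<open>xpt_recursion\<close>). The sequence \<open>1 - l n / 4\<close> solves it
  when \<open>u (q 0) = 1\<close>, and the vanishing normal derivative excludes any multiple of the
  homogeneous solution.

  What all this needs from geometry is that two distinct cells of one level meet in at most one
  point, a corner of both, so that every vertex outside \<open>V_0\<close> has its neighbours in exactly two
  cells. Cells are located with barycentric coordinates.
\<close>

section \<open>Barycentric coordinates and the solid triangle\<close>

definition letters :: "nat set" where "letters = {0, 1, 2}"

lemma letters_simps [simp]: "0 \<in> letters" "1 \<in> letters" "Suc 0 \<in> letters" "2 \<in> letters" "finite letters"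
  by (auto simp: letters_def)

definition centroid :: "(nat \<Rightarrow> real^2) \<Rightarrow> real^2" where
  "centroid q = (1/3) *\<^sub>R (q 0 + q 1 + q 2)"

text \<open>
  For an equilateral triangle of side \<open>s\<close>, the vectors from the centroid to the corners have
  squared length \<open>s^2 / 3\<close> and mutual inner products \<open>- s^2 / 6\<close>; the constants are chosen so
  that this becomes the barycentric coordinate of \<open>x\<close> with respect to \<open>q k\<close>.
\<close>
definition bary :: "(nat \<Rightarrow> real^2) \<Rightarrow> nat \<Rightarrow> real^2 \<Rightarrow> real" where
  "bary q k x = 1/3 + 2 / (dist (q 0) (q 1))\<^sup>2 * ((x - centroid q) \<bullet> (q k - centroid q))"

text \<open>
  The two equations say that \<open>x\<close> is recovered from its coordinates. For a nondegenerate triangle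
  they hold on the whole plane; as part of the definition they make coordinates separate points
  without an argument about dimension.
\<close>
definition solid_triangle :: "(nat \<Rightarrow> real^2) \<Rightarrow> (real^2) set" where
  "solid_triangle q = {x. (\<forall>k\<in>letters. bary q k x \<ge> 0) \<and> bary q 0 x + bary q 1 x + bary q 2 x = 1
      \<and> x = bary q 0 x *\<^sub>R q 0 + bary q 1 x *\<^sub>R q 1 + bary q 2 x *\<^sub>R q 2}"

lemma F_fixed: "F q i (q i) = q i"
  by (simp add: F_def scaleR_2[symmetric])

lemma F_swap: "F q i (q j) = F q j (q i)"
  by (simp add: F_def add.commute)

lemma F_inject: "F q i x = F q i y \<longleftrightarrow> x = y"
  by (simp add: F_def)

lemma Fword_inject: "Fword q w x = Fword q w y \<longleftrightarrow> x = y"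
  by (induction w) (auto simp: F_inject)

lemma Fword_append: "Fword q (v @ w) x = Fword q v (Fword q w x)"
  by (induction v) auto

lemma bary_F: "bary q k (F q i x) = (bary q k x + bary q k (q i)) / 2"
proof -
  define c where "c = 2 / (dist (q 0) (q 1))\<^sup>2"
  define e where "e = q k - centroid q"
  have "F q i x - centroid q = (1/2) *\<^sub>R ((x - centroid q) + (q i - centroid q))"
    by (simp add: F_def vec_eq_iff field_simps)
  then have "(F q i x - centroid q) \<bullet> e = ((x - centroid q) \<bullet> e + (q i - centroid q) \<bullet> e) / 2"
    by (simp only: inner_add_left inner_scaleR_left)
  then show ?thesis
    unfolding bary_def c_def[symmetric] e_def[symmetric] by (simp add: algebra_simps)
qed

lemma continuous_bary: "continuous_on UNIV (bary q k)"
  unfolding bary_def by (intro continuous_intros)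

lemma closed_solid_triangle: "closed (solid_triangle q)"
proof -
  have "solid_triangle q = {x. 0 \<le> bary q 0 x} \<inter> {x. 0 \<le> bary q 1 x} \<inter> {x. 0 \<le> bary q 2 x}
      \<inter> {x. bary q 0 x + bary q 1 x + bary q 2 x = 1}
      \<inter> {x. x = bary q 0 x *\<^sub>R q 0 + bary q 1 x *\<^sub>R q 1 + bary q 2 x *\<^sub>R q 2}"
    unfolding solid_triangle_def letters_def by auto
  then show ?thesis
    by (auto intro!: closed_Int closed_Collect_le closed_Collect_eq continuous_intros
        continuous_bary)
qed

lemma solid_triangle_eqI:
  assumes "x \<in> solid_triangle q" "y \<in> solid_triangle q" "\<And>k. k \<in> letters \<Longrightarrow> bary q k x = bary q k y"
  shows "x = y"
proof -
  have "x = bary q 0 x *\<^sub>R q 0 + bary q 1 x *\<^sub>R q 1 + bary q 2 x *\<^sub>R q 2"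
    "y = bary q 0 y *\<^sub>R q 0 + bary q 1 y *\<^sub>R q 1 + bary q 2 y *\<^sub>R q 2"
    using assms(1,2) unfolding solid_triangle_def by blast+
  then show ?thesis using assms(3) by simp
qed

locale gasket =
  fixes q :: "nat \<Rightarrow> real^2"
  assumes equilateral: "equilateral q"
begin

lemma bary_vertex:
  assumes "i \<in> letters" "k \<in> letters"
  shows "bary q k (q i) = (if i = k then 1 else 0)"
proof -
  let ?a = "q 1 - q 0" and ?b = "q 2 - q 0"
  obtain s where s0: "s > 0" "dist (q 0) (q 1) = s" "dist (q 1) (q 2) = s" "dist (q 2) (q 0) = s"
    using equilateral unfolding equilateral_def by blast
  have s: "s > 0" "norm ?a = s" "norm (?b - ?a) = s" "norm ?b = s"
    using s0 by (simp_all add: dist_norm norm_minus_commute)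
  then have "?a \<bullet> ?a = s\<^sup>2" "?b \<bullet> ?b = s\<^sup>2" "(?b - ?a) \<bullet> (?b - ?a) = s\<^sup>2"
    by (metis power2_norm_eq_inner)+
  then have ip: "?a \<bullet> ?a = s\<^sup>2" "?b \<bullet> ?b = s\<^sup>2" "?a \<bullet> ?b = s\<^sup>2 / 2" "?b \<bullet> ?a = s\<^sup>2 / 2"
    by (auto simp: inner_diff_left inner_diff_right inner_commute)
  define a b where "a = ?a" and "b = ?b"
  have c: "q 0 - centroid q = (-1/3) *\<^sub>R (a + b)"
      "q 1 - centroid q = (1/3) *\<^sub>R (2 *\<^sub>R a - b)"
      "q 2 - centroid q = (1/3) *\<^sub>R (2 *\<^sub>R b - a)"
    unfolding centroid_def a_def b_def vec_eq_iff by (simp_all add: field_simps)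
  have "(q i - centroid q) \<bullet> (q k - centroid q) = (if i = k then s\<^sup>2 / 3 else - (s\<^sup>2) / 6)"
    if "i = 0 \<or> i = 1 \<or> i = 2" "k = 0 \<or> k = 1 \<or> k = 2"
    using that
    by (elim disjE; simp only: c; simp add: ip[folded a_def b_def] inner_diff_left inner_diff_right
        inner_add_left inner_add_right)
  then show ?thesis
    using assms s(1) unfolding bary_def s0 letters_def by auto
qed

lemma vertex_in_solid_triangle: "i \<in> letters \<Longrightarrow> q i \<in> solid_triangle q"
  by (auto simp: solid_triangle_def bary_vertex letters_def)

lemma F_solid_triangle:
  assumes "i \<in> letters" "x \<in> solid_triangle q" shows "F q i x \<in> solid_triangle q"
proof -
  have x: "x = bary q 0 x *\<^sub>R q 0 + bary q 1 x *\<^sub>R q 1 + bary q 2 x *\<^sub>R q 2"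
    and q: "q i = bary q 0 (q i) *\<^sub>R q 0 + bary q 1 (q i) *\<^sub>R q 1 + bary q 2 (q i) *\<^sub>R q 2"
    and nn: "\<forall>k\<in>letters. bary q k x \<ge> 0" "\<forall>k\<in>letters. bary q k (q i) \<ge> 0"
    and sm: "bary q 0 x + bary q 1 x + bary q 2 x = 1" "bary q 0 (q i) + bary q 1 (q i) + bary q 2 (q i) = 1"
    using assms vertex_in_solid_triangle[OF assms(1)] unfolding solid_triangle_def by blast+
  have "F q i x = (1/2) *\<^sub>R ((bary q 0 x *\<^sub>R q 0 + bary q 1 x *\<^sub>R q 1 + bary q 2 x *\<^sub>R q 2)
      + (bary q 0 (q i) *\<^sub>R q 0 + bary q 1 (q i) *\<^sub>R q 1 + bary q 2 (q i) *\<^sub>R q 2))"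
    unfolding F_def using x q by simp
  also have "\<dots> = bary q 0 (F q i x) *\<^sub>R q 0 + bary q 1 (F q i x) *\<^sub>R q 1 + bary q 2 (F q i x) *\<^sub>R q 2"
    unfolding bary_F by (simp add: algebra_simps add_divide_distrib)
  finally have comb: "F q i x = bary q 0 (F q i x) *\<^sub>R q 0 + bary q 1 (F q i x) *\<^sub>R q 1
      + bary q 2 (F q i x) *\<^sub>R q 2" .
  have "\<forall>k\<in>letters. bary q k (F q i x) \<ge> 0"
    using nn by (simp add: bary_F)
  moreover have "bary q 0 (F q i x) + bary q 1 (F q i x) + bary q 2 (F q i x) = 1"
    using sm unfolding bary_F by argo
  ultimately show ?thesis
    unfolding solid_triangle_def mem_Collect_eq using comb by blast
qed

text \<open>
  On the image under \<open>F_i\<close> the \<open>i\<close>-th coordinate is at least \<open>1/2\<close>. In the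
  intersection both the \<open>i\<close>-th and the \<open>j\<close>-th are, so they equal \<open>1/2\<close> and the third is \<open>0\<close>.
\<close>
lemma solid_triangle_image_Int:
  assumes "i \<in> letters" "j \<in> letters" "i \<noteq> j"
    and "x \<in> F q i ` solid_triangle q" "x \<in> F q j ` solid_triangle q"
  shows "x = F q i (q j)"
proof (rule solid_triangle_eqI)
  show x: "x \<in> solid_triangle q" "F q i (q j) \<in> solid_triangle q"
    using assms F_solid_triangle vertex_in_solid_triangle by auto
  obtain y z where yz: "y \<in> solid_triangle q" "z \<in> solid_triangle q" "x = F q i y" "x = F q j z"
    using assms(4,5) by blast
  have "bary q i y \<ge> 0" "bary q j z \<ge> 0"
    using yz assms unfolding solid_triangle_def by blast+
  then have half: "bary q i x \<ge> 1/2" "bary q j x \<ge> 1/2"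
    using bary_F[of q i i y, folded yz(3)] bary_F[of q j j z, folded yz(4)] assms(1,2)
    by (simp_all add: bary_vertex)
  have "\<forall>k\<in>letters. bary q k x \<ge> 0" "bary q 0 x + bary q 1 x + bary q 2 x = 1"
    using x(1) unfolding solid_triangle_def by blast+
  then show "bary q k x = bary q k (F q i (q j))" if "k \<in> letters" for k
    using half assms(1-3) that unfolding letters_def by (auto simp: bary_F bary_vertex)
qed

lemma vertex_in_solid_triangle_image:
  assumes "i \<in> letters" "j \<in> letters" "q j \<in> F q i ` solid_triangle q"
  shows "i = j"
proof (rule ccontr)
  assume ij: "i \<noteq> j"
  obtain y where y: "y \<in> solid_triangle q" "q j = F q i y" using assms(3) by blast
  have "bary q j (q j) = (bary q j y + bary q j (q i)) / 2" unfolding y(2) bary_F ..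
  then have "bary q j y = 2" using assms ij by (simp add: bary_vertex)
  moreover have "\<forall>k\<in>letters. bary q k y \<ge> 0" "bary q 0 y + bary q 1 y + bary q 2 y = 1"
    using y(1) unfolding solid_triangle_def by blast+
  ultimately show False using assms(2) unfolding letters_def by auto
qed

end

section \<open>Self-similarity and the vertex sets\<close>
lemma words_letters: "words m = {w. set w \<subseteq> letters \<and> length w = m}"
  by (simp add: words_def letters_def)

lemma V_0: "V q 0 = q ` letters"
  by (auto simp: letters_def)

lemma V_Suc: "V q (Suc m) = (\<Union>i\<in>letters. F q i ` V q m)"
  by (simp add: letters_def)

declare V.simps [simp del]

lemma words_0: "words 0 = {[]}"
  by (auto simp: words_letters)

lemma words_Suc: "words (Suc m) = {i # w | i w. i \<in> letters \<and> w \<in> words m}"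
  by (auto simp: words_letters length_Suc_conv)

lemma words_snoc: "w \<in> words m \<Longrightarrow> i \<in> letters \<Longrightarrow> w @ [i] \<in> words (Suc m)"
  by (auto simp: words_letters)

lemma V_eq_words: "V q m = {Fword q w (q i) | w i. w \<in> words m \<and> i \<in> letters}"
proof (induction m)
  case 0
  then show ?case by (auto simp: words_0 V_0)
next
  case (Suc m)
  show ?case
  proof (intro equalityI subsetI)
    fix x assume "x \<in> V q (Suc m)"
    then obtain k w i where "k \<in> letters" "w \<in> words m" "i \<in> letters" "x = F q k (Fword q w (q i))"
      unfolding V_Suc Suc by blast
    then have "k # w \<in> words (Suc m)" "x = Fword q (k # w) (q i)" "i \<in> letters"
      by (auto simp: words_Suc)
    then show "x \<in> {Fword q w (q i) | w i. w \<in> words (Suc m) \<and> i \<in> letters}" by blast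
  next
    fix x assume "x \<in> {Fword q w (q i) | w i. w \<in> words (Suc m) \<and> i \<in> letters}"
    then obtain k w i where "k \<in> letters" "w \<in> words m" "i \<in> letters" "x = F q k (Fword q w (q i))"
      unfolding words_Suc by auto
    then show "x \<in> V q (Suc m)"
      unfolding V_Suc Suc by blast
  qed
qed

definition self_similar :: "(nat \<Rightarrow> real^2) \<Rightarrow> (real^2) set \<Rightarrow> bool" where
  "self_similar q K \<longleftrightarrow> compact K \<and> K \<noteq> {} \<and> K = (\<Union>i\<in>letters. F q i ` K)"

lemma dist_F: "dist (F q i x) (F q i y) = dist x y / 2"
  by (simp add: F_def dist_norm scaleR_right_diff_distrib[symmetric] del: scaleR_right_diff_distrib)

text \<open>
  A point of \<open>K\<close> at maximal distance from \<open>L\<close> is \<open>F_i y\<close> for some \<open>y\<close> in \<open>K\<close>; as \<open>F_i\<close> halves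
  distances and maps \<open>L\<close> into itself, the maximum is at most half of itself. By symmetry the
  nonempty compact self-similar set is unique, which gives meaning to the description of \<open>SG\<close>.
\<close>
lemma self_similar_subset:
  assumes "self_similar q K" "self_similar q L"
  shows "K \<subseteq> L"
proof -
  have K: "compact K" "K \<noteq> {}" "K = (\<Union>i\<in>letters. F q i ` K)"
    and L: "compact L" "L \<noteq> {}" "L = (\<Union>i\<in>letters. F q i ` L)"
    using assms unfolding self_similar_def by blast+
  have "continuous_on K (\<lambda>x. infdist x L)"
    by (intro continuous_intros)
  then obtain x where x: "x \<in> K" "\<And>y. y \<in> K \<Longrightarrow> infdist y L \<le> infdist x L"
    using continuous_attains_sup[OF K(1,2)] by blast
  obtain i y where i: "i \<in> letters" "y \<in> K" "x = F q i y"
    using K(3) x(1) by blast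
  obtain z where z: "z \<in> L" "infdist y L = dist y z"
    using infdist_attains_inf[OF compact_imp_closed[OF L(1)] L(2)] by blast
  have "F q i z \<in> L" using L(3) z(1) i(1) by blast
  then have "infdist x L \<le> dist (F q i y) (F q i z)"
    unfolding i(3) by (rule infdist_le)
  also have "\<dots> = infdist y L / 2" by (simp add: dist_F z(2))
  also have "\<dots> \<le> infdist x L / 2" using x(2)[OF i(2)] by simp
  finally have "infdist x L \<le> 0" by simp
  then have "infdist w L = 0" if "w \<in> K" for w
    using x(2)[OF that] infdist_nonneg[of w L] by linarith
  then show ?thesis
    using in_closed_iff_infdist_zero[OF compact_imp_closed[OF L(1)] L(2)] by blast
qed

lemma V_mono_Suc: "V q m \<subseteq> V q (Suc m)"
proof (induction m)
  case 0
  have "q i = F q i (q i)" for i by (simp add: F_fixed)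
  then show ?case unfolding V_Suc V_0 by blast
next
  case (Suc m)
  then show ?case unfolding V_Suc[of q "Suc m"] by (subst V_Suc) blast
qed

context gasket
begin

lemma V_solid_triangle: "V q m \<subseteq> solid_triangle q"
proof (induction m)
  case 0
  then show ?case using vertex_in_solid_triangle by (auto simp: V_0)
next
  case (Suc m)
  then show ?case using F_solid_triangle by (auto simp: subset_iff V_Suc)
qed

lemma bounded_solid_triangle: "bounded (solid_triangle q)"
proof -
  have "norm x \<le> norm (q 0) + norm (q 1) + norm (q 2)" if "x \<in> solid_triangle q" for x
  proof -
    have x: "x = bary q 0 x *\<^sub>R q 0 + bary q 1 x *\<^sub>R q 1 + bary q 2 x *\<^sub>R q 2"
      and b: "\<forall>k\<in>letters. bary q k x \<ge> 0" "bary q 0 x + bary q 1 x + bary q 2 x = 1"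
      using that unfolding solid_triangle_def by blast+
    have "bary q k x * norm (q k) \<le> norm (q k)" if "k \<in> letters" for k
      using b that by (intro mult_left_le_one_le) (auto simp: letters_def)
    then have "norm (bary q k x *\<^sub>R q k) \<le> norm (q k)" if "k \<in> letters" for k
      using b(1) that by simp
    then show ?thesis
      by (subst x) (intro norm_triangle_le add_mono; simp)
  qed
  then show ?thesis by (auto simp: bounded_iff)
qed

text \<open>
  The union of all \<open>V_m\<close> is invariant because the \<open>V_m\<close> increase; closure commutes with the
  similarities \<open>F_i\<close> and with finite unions.
\<close>
lemma self_similar_closure_V: "self_similar q (closure (\<Union>m. V q m))"
proof -
  define W where "W = (\<Union>m. V q m)"
  have "W \<subseteq> solid_triangle q" using V_solid_triangle by (auto simp: W_def)
  then have "bounded W" using bounded_solid_triangle bounded_subset by blast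
  then have cW: "compact (closure W)" by simp
  have 1: "(\<Union>i\<in>letters. F q i ` W) = W"
  proof
    show "(\<Union>i\<in>letters. F q i ` W) \<subseteq> W"
    proof
      fix x assume "x \<in> (\<Union>i\<in>letters. F q i ` W)"
      then obtain i m where "i \<in> letters" "x \<in> F q i ` V q m" unfolding W_def by blast
      then have "x \<in> V q (Suc m)" unfolding V_Suc by blast
      then show "x \<in> W" unfolding W_def by blast
    qed
    show "W \<subseteq> (\<Union>i\<in>letters. F q i ` W)"
    proof
      fix x assume "x \<in> W"
      then obtain m where "x \<in> V q (Suc m)" unfolding W_def using V_mono_Suc by blast
      then show "x \<in> (\<Union>i\<in>letters. F q i ` W)" unfolding V_Suc W_def by blast
    qed
  qed
  have 2: "F q i ` closure W = closure (F q i ` W)" for i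
  proof -
    have "F q i = (\<lambda>x. (1/2) *\<^sub>R q i + (1/2) *\<^sub>R x)" by (auto simp: F_def algebra_simps)
    then have *: "F q i ` X = (+) ((1/2) *\<^sub>R q i) ` (\<lambda>x. (1/2) *\<^sub>R x) ` X" for X
      by (simp add: image_image)
    show ?thesis unfolding * by (simp add: closure_translation closure_scaleR)
  qed
  have "closure W = (\<Union>i\<in>letters. F q i ` closure W)"
    unfolding 2 using arg_cong[OF 1, of closure] by (simp add: closure_Un letters_def)
  moreover have "closure W \<noteq> {}" unfolding W_def using V_0[of q] letters_simps(1) closure_eq_empty by blast
  ultimately show ?thesis using cW unfolding self_similar_def W_def[symmetric] by (intro conjI)
qed

lemma SG_eq_closure: "SG q = closure (\<Union>m. V q m)"
proof -
  have "SG q = (THE K. self_similar q K)" unfolding SG_def self_similar_def letters_def ..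
  also have "\<dots> = closure (\<Union>m. V q m)"
  proof (rule the_equality)
    show "K = closure (\<Union>m. V q m)" if "self_similar q K" for K
      using self_similar_subset[OF that self_similar_closure_V]
        self_similar_subset[OF self_similar_closure_V that] by (rule subset_antisym)
  qed (rule self_similar_closure_V)
  finally show ?thesis .
qed

lemma self_similar_SG: "self_similar q (SG q)"
  unfolding SG_eq_closure by (rule self_similar_closure_V)

lemma compact_SG: "compact (SG q)"
  using self_similar_SG unfolding self_similar_def by (rule conjunct1)

lemma F_SG:
  assumes "i \<in> letters" "x \<in> SG q" shows "F q i x \<in> SG q"
proof -
  have "SG q = (\<Union>i\<in>letters. F q i ` SG q)"
    using self_similar_SG unfolding self_similar_def by (elim conjE)
  then show ?thesis by (rule ssubst) (use assms in blast)
qed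

lemma V_SG: "V q m \<subseteq> SG q"
proof -
  have "V q m \<subseteq> (\<Union>m. V q m)" by blast
  also have "\<dots> \<subseteq> SG q" unfolding SG_eq_closure by (rule closure_subset)
  finally show ?thesis .
qed

lemma vertex_SG: "i \<in> letters \<Longrightarrow> q i \<in> SG q"
  using V_SG[of 0] by (auto simp: V_0)

lemma SG_solid_triangle: "SG q \<subseteq> solid_triangle q"
  unfolding SG_eq_closure using V_solid_triangle closed_solid_triangle by (intro closure_minimal) auto

lemma Fword_solid_triangle: "w \<in> words m \<Longrightarrow> x \<in> solid_triangle q \<Longrightarrow> Fword q w x \<in> solid_triangle q"
  by (induction m arbitrary: w) (auto simp: words_0 words_Suc intro!: F_solid_triangle)

section \<open>How cells meet\<close>
lemma cell_Cons_subset: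
  "w \<in> words m \<Longrightarrow> Fword q (i # w) ` solid_triangle q \<subseteq> F q i ` solid_triangle q"
  using Fword_solid_triangle by auto

text \<open>
  A corner \<open>q j\<close> of the large triangle lies only in the cell with address \<open>j j ... j\<close>.
\<close>
lemma cell_corner_word:
  assumes "w \<in> words m" "w' \<in> words m" "j \<in> letters"
    "q j \<in> Fword q w ` solid_triangle q" "q j \<in> Fword q w' ` solid_triangle q"
  shows "w = w'"
proof -
  have "w = replicate m j" if "w \<in> words m" "q j \<in> Fword q w ` solid_triangle q" for w
    using that
  proof (induction m arbitrary: w)
    case 0
    then show ?case by (simp add: words_0)
  next
    case (Suc m)
    then obtain i v where v: "w = i # v" "i \<in> letters" "v \<in> words m"
      by (auto simp: words_Suc)
    obtain y where y: "y \<in> solid_triangle q" "q j = F q i (Fword q v y)"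
      using Suc.prems(2) v by auto
    then have "i = j"
      using vertex_in_solid_triangle_image[OF v(2) assms(3)] Fword_solid_triangle[OF v(3)] by blast
    then have "F q j (q j) = F q j (Fword q v y)" using y(2) \<open>i = j\<close> F_fixed[of q j] by argo
    then have "q j = Fword q v y" by (simp add: F_inject)
    then have "v = replicate m j" using Suc.IH[OF v(3)] y(1) by blast
    then show ?case using v(1) \<open>i = j\<close> by simp
  qed
  then show ?thesis using assms by blast
qed

text \<open>
  Strip the common prefix of the two addresses. At the first difference \<open>i \<noteq> j\<close> the
  point becomes \<open>F_i (q j)\<close>, and the rest of the first address is forced to be \<open>j j ... j\<close>.
\<close>
lemma cells_meet_in_corner:
  assumes "v \<in> words m" "w \<in> words m" "v \<noteq> w"
    "x \<in> Fword q v ` solid_triangle q" "x \<in> Fword q w ` solid_triangle q"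
  shows "\<exists>k\<in>letters. x = Fword q v (q k)"
  using assms
proof (induction m arbitrary: v w x)
  case 0
  then show ?case by (auto simp: words_0)
next
  case (Suc m)
  then obtain i v' j w' where vw: "v = i # v'" "i \<in> letters" "v' \<in> words m"
    "w = j # w'" "j \<in> letters" "w' \<in> words m"
    by (auto simp: words_Suc)
  obtain y z where yz: "y \<in> solid_triangle q" "x = F q i (Fword q v' y)"
      "z \<in> solid_triangle q" "x = F q j (Fword q w' z)"
    using Suc.prems vw by auto
  show ?case
  proof (cases "i = j")
    case True
    then have "Fword q v' y = Fword q w' z" using yz by (simp add: F_inject)
    then have "\<exists>k\<in>letters. Fword q v' y = Fword q v' (q k)"
      using Suc.IH[OF vw(3,6), of "Fword q v' y"] Suc.prems(3) True vw yz by force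
    then show ?thesis using vw yz by auto
  next
    case False
    then have x: "x = F q i (q j)"
      using solid_triangle_image_Int[OF vw(2,5) False] yz Fword_solid_triangle vw by blast
    then have y: "Fword q v' y = q j" using yz by (simp add: F_inject)
    have "\<exists>k\<in>letters. q j = Fword q v' (q k)"
    proof -
      have r: "replicate m j \<in> words m" using vw(5) by (auto simp: words_letters)
      have f: "Fword q (replicate m j) (q j) = q j" by (induction m) (auto simp: F_fixed)
      have "v' = replicate m j"
        using cell_corner_word[OF vw(3) r vw(5)] yz(1) y f vertex_in_solid_triangle[OF vw(5)] by (metis imageI)
      then show ?thesis using f vw(5) by metis
    qed
    then show ?thesis using x vw by auto
  qed
qed

lemma cells_meet_once:
  assumes "v \<in> words m" "w \<in> words m" "v \<noteq> w"
    "x \<in> Fword q v ` solid_triangle q" "x \<in> Fword q w ` solid_triangle q"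
    "y \<in> Fword q v ` solid_triangle q" "y \<in> Fword q w ` solid_triangle q"
  shows "x = y"
  using assms
proof (induction m arbitrary: v w x y)
  case 0
  then show ?case by (auto simp: words_0)
next
  case (Suc m)
  then obtain i v' j w' where vw: "v = i # v'" "i \<in> letters" "v' \<in> words m"
    "w = j # w'" "j \<in> letters" "w' \<in> words m"
    by (auto simp: words_Suc)
  show ?case
  proof (cases "i = j")
    case True
    obtain a b where ab: "x = F q i (Fword q v' a)" "x = F q i (Fword q w' b)"
        "a \<in> solid_triangle q" "b \<in> solid_triangle q"
      using Suc.prems(4,5) unfolding vw True Fword.simps o_def by blast
    obtain c d where cd: "y = F q i (Fword q v' c)" "y = F q i (Fword q w' d)"
        "c \<in> solid_triangle q" "d \<in> solid_triangle q"
      using Suc.prems(6,7) unfolding vw True Fword.simps o_def by blast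
    have "Fword q v' a = Fword q w' b" "Fword q v' c = Fword q w' d"
      using ab cd by (simp_all add: F_inject)
    moreover have "v' \<noteq> w'" using Suc.prems(3) vw True by blast
    ultimately have "Fword q v' a = Fword q v' c"
      using Suc.IH[OF vw(3,6)] ab cd by (metis imageI)
    then show ?thesis using ab cd by simp
  next
    case False
    have meet: "z = F q i (q j)" if "z \<in> Fword q v ` solid_triangle q" "z \<in> Fword q w ` solid_triangle q" for z
      using that cell_Cons_subset[OF vw(3), of i] cell_Cons_subset[OF vw(6), of j]
      unfolding vw(1,4) by (intro solid_triangle_image_Int[OF vw(2,5) False]) auto
    show ?thesis
      by (rule trans[OF meet[OF Suc.prems(4,5)] meet[OF Suc.prems(6,7), symmetric]])
  qed
qed

text \<open>
  If the addresses of three cells with a common point first differ in three distinct letters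
  \<open>i\<close>, \<open>j\<close>, \<open>k\<close>, the point is both \<open>F_i (q j)\<close> and \<open>F_i (q k)\<close>. If two of these letters agree,
  \<open>cell_corner_word\<close> forces the corresponding addresses to coincide.
\<close>
lemma at_most_two_cells:
  assumes "u \<in> words m" "v \<in> words m" "w \<in> words m" "u \<noteq> v"
    "x \<in> Fword q u ` solid_triangle q" "x \<in> Fword q v ` solid_triangle q" "x \<in> Fword q w ` solid_triangle q"
  shows "w = u \<or> w = v"
  using assms
proof (induction m arbitrary: u v w x)
  case 0
  then show ?case by (auto simp: words_0)
next
  case (Suc m)
  obtain i u' j v' k w' where uvw: "u = i # u'" "i \<in> letters" "u' \<in> words m"
    "v = j # v'" "j \<in> letters" "v' \<in> words m" "w = k # w'" "k \<in> letters" "w' \<in> words m"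
    using Suc.prems(1-3) unfolding words_Suc by blast
  obtain a b c where abc: "x = F q i (Fword q u' a)" "x = F q j (Fword q v' b)"
    "x = F q k (Fword q w' c)" "a \<in> solid_triangle q" "b \<in> solid_triangle q" "c \<in> solid_triangle q"
    using Suc.prems(5-7) unfolding uvw Fword.simps o_def by blast
  have junction: "w2 = w1" if "l1 \<noteq> l2" "l1 \<in> letters" "l2 \<in> letters"
    "x \<in> F q l2 ` solid_triangle q" "w1 \<in> words m" "w2 \<in> words m"
    "x = F q l1 (Fword q w1 d)" "x = F q l1 (Fword q w2 e)" "d \<in> solid_triangle q" "e \<in> solid_triangle q"
    for l1 l2 w1 w2 d e
  proof -
    have "x = F q l1 (q l2)"
      using solid_triangle_image_Int[OF that(2,3,1)] that Fword_solid_triangle by blast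
    then have "Fword q w1 d = q l2" "Fword q w2 e = q l2" using that F_inject by metis+
    then show ?thesis using cell_corner_word[OF that(6,5,3)] that by (metis imageI)
  qed
  have inT: "x \<in> F q i ` solid_triangle q" "x \<in> F q j ` solid_triangle q" "x \<in> F q k ` solid_triangle q"
    using abc uvw Fword_solid_triangle by blast+
  show ?case
  proof (cases "i = j")
    case True
    show ?thesis
    proof (cases "k = i")
      case ki: True
      have "Fword q v' b = Fword q u' a" "Fword q w' c = Fword q u' a"
        using abc(1-3) unfolding True ki F_inject by (simp_all add: F_inject)
      moreover have "u' \<noteq> v'" using Suc.prems(4) uvw(1,4) True by blast
      ultimately have "w' = u' \<or> w' = v'"
        using Suc.IH[OF uvw(3,6,9), of "Fword q u' a"] abc(4-6) by (metis imageI)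
      then show ?thesis using uvw True ki by blast
    next
      case False
      have "u' = v'"
        using junction[OF _ uvw(2,8) inT(3) uvw(6,3)] abc True False by blast
      then show ?thesis using Suc.prems(4) uvw True by blast
    qed
  next
    case False
    have xij: "x = F q i (q j)" using solid_triangle_image_Int[OF uvw(2,5) False inT(1,2)] .
    consider "k = i" | "k = j" | "k \<noteq> i" "k \<noteq> j" by blast
    then show ?thesis
    proof cases
      case 1
      then have "w' = u'" using junction[OF False uvw(2,5) inT(2) uvw(3,9)] abc by blast
      then show ?thesis using 1 uvw by blast
    next
      case 2
      then have "w' = v'" using junction[OF False[symmetric] uvw(5,2) inT(1) uvw(6,9)] abc by blast
      then show ?thesis using 2 uvw by blast
    next
      case 3
      have "x = F q i (q k)" using solid_triangle_image_Int[OF uvw(2,8) 3(1)[symmetric] inT(1,3)] .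
      then have "q j = q k" using xij F_inject by metis
      then have "bary q j (q j) = bary q j (q k)" by simp
      then show ?thesis using 3 bary_vertex uvw by simp
    qed
  qed
qed

lemma vertex_inject: "i \<in> letters \<Longrightarrow> j \<in> letters \<Longrightarrow> q i = q j \<longleftrightarrow> i = j"
  using bary_vertex[of i i] bary_vertex[of j i] by (auto split: if_splits)

text \<open>
  The contribution of the single cell \<open>F_w\<close> to the graph Laplacian at its \<open>i\<close>-th corner.
\<close>
definition cell_diff :: "(real^2 \<Rightarrow> real) \<Rightarrow> nat list \<Rightarrow> nat \<Rightarrow> real" where
  "cell_diff u w i = (\<Sum>k\<in>letters. u (Fword q w (q k)) - u (Fword q w (q i)))"

text \<open>
  This is the only bridge from the adjacency relation to words: at a vertex shared by two cells
  the graph Laplacian splits into the contributions of these cells. The neighbours are the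
  remaining corners, by \<open>at_most_two_cells\<close> and \<open>cells_meet_in_corner\<close>, and no neighbour is counted
  twice, by \<open>cells_meet_once\<close>.
\<close>
lemma graph_laplacian_two_cells:
  assumes v: "v \<in> words m" "w \<in> words m" "v \<noteq> w" and ij: "i \<in> letters" "j \<in> letters"
    and x: "x = Fword q v (q i)" "x = Fword q w (q j)"
  shows "graph_laplacian q m u x = cell_diff u v i + cell_diff u w j"
proof -
  define A where "A = (\<lambda>k. Fword q v (q k)) ` (letters - {i})"
  define B where "B = (\<lambda>k. Fword q w (q k)) ` (letters - {j})"
  have inj: "inj_on (\<lambda>k. Fword q z (q k)) letters" for z
    by (auto simp: inj_on_def Fword_inject vertex_inject)
  have xv: "x \<in> Fword q v ` solid_triangle q" "x \<in> Fword q w ` solid_triangle q"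
    using vertex_in_solid_triangle[OF ij(1)] vertex_in_solid_triangle[OF ij(2)] x
    by (metis imageI)+
  have "{y. adj q m x y} = A \<union> B"
  proof (intro equalityI subsetI)
    fix y assume "y \<in> {y. adj q m x y}"
    then obtain z where y: "y \<in> V q m" "x \<noteq> y" "z \<in> words m" "x \<in> Fword q z ` SG q" "y \<in> Fword q z ` SG q"
      unfolding adj_def by blast
    then have xz: "x \<in> Fword q z ` solid_triangle q" "y \<in> Fword q z ` solid_triangle q" using SG_solid_triangle by auto
    then have z: "z = v \<or> z = w" using at_most_two_cells[OF v(1,2) y(3) v(3) xv] by blast
    obtain t l where t: "t \<in> words m" "l \<in> letters" "y = Fword q t (q l)"
      using y(1) unfolding V_eq_words by blast
    have "y \<in> Fword q t ` solid_triangle q" using t vertex_in_solid_triangle by blast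
    then have "\<exists>k\<in>letters. y = Fword q z (q k)"
      using cells_meet_in_corner[OF y(3) t(1) _ xz(2)] t by metis
    then show "y \<in> A \<union> B"
      using z x y(2) unfolding A_def B_def by blast
  next
    fix y assume y: "y \<in> A \<union> B"
    have "x \<in> V q m" unfolding V_eq_words using v ij x by blast
    moreover have "y \<in> V q m" using y v unfolding V_eq_words A_def B_def by blast
    moreover have "x \<noteq> y"
      using y
    proof
      assume "y \<in> A"
      then show ?thesis unfolding A_def x(1) using ij by (auto simp: Fword_inject vertex_inject)
    next
      assume "y \<in> B"
      then show ?thesis unfolding B_def x(2) using ij by (auto simp: Fword_inject vertex_inject)
    qed
    moreover have "\<exists>z\<in>words m. x \<in> Fword q z ` SG q \<and> y \<in> Fword q z ` SG q"
      using y
    proof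
      assume "y \<in> A"
      then show ?thesis using vertex_SG v(1) ij x(1) unfolding A_def by blast
    next
      assume "y \<in> B"
      then show ?thesis using vertex_SG v(2) ij x(2) unfolding B_def by blast
    qed
    ultimately show "y \<in> {y. adj q m x y}" unfolding adj_def by blast
  qed
  moreover have "A \<inter> B = {}"
  proof (rule ccontr)
    assume "A \<inter> B \<noteq> {}"
    then obtain k l where kl: "k \<in> letters" "k \<noteq> i" "l \<in> letters" "Fword q v (q k) = Fword q w (q l)"
      unfolding A_def B_def by auto
    then have "Fword q v (q k) = x"
      using cells_meet_once[OF v] xv vertex_in_solid_triangle by (metis imageI)
    then show False using kl ij x by (simp add: Fword_inject vertex_inject)
  qed
  moreover have "finite A" "finite B" unfolding A_def B_def by auto
  ultimately have "graph_laplacian q m u x = (\<Sum>y\<in>A. u y - u x) + (\<Sum>y\<in>B. u y - u x)"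
    unfolding graph_laplacian_def by (simp add: sum.union_disjoint)
  moreover have "(\<Sum>y\<in>A. u y - u x) = cell_diff u v i"
    unfolding A_def cell_diff_def x(1) using ij
    by (subst sum.reindex) (auto intro: inj_on_subset[OF inj] simp: sum_diff1)
  moreover have "(\<Sum>y\<in>B. u y - u x) = cell_diff u w j"
    unfolding B_def cell_diff_def x(2) using ij
    by (subst sum.reindex) (auto intro: inj_on_subset[OF inj] simp: sum_diff1)
  ultimately show ?thesis by simp
qed

text \<open>
  A vertex that is new at level \<open>m\<close> has an address \<open>w i k\<close> with \<open>i \<noteq> k\<close> and hence also the
  address \<open>w k i\<close>. A vertex inherited from an earlier level keeps its two cells, each
  replaced by its subcell at the vertex.
\<close>
lemma interior_vertex_two_cells:
  assumes "x \<in> V q m" "x \<notin> V q 0"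
  obtains v w i j where "v \<in> words m" "w \<in> words m" "v \<noteq> w" "i \<in> letters" "j \<in> letters"
    "x = Fword q v (q i)" "x = Fword q w (q j)"
proof -
  have "\<exists>v w i j. v \<in> words m \<and> w \<in> words m \<and> v \<noteq> w \<and> i \<in> letters \<and> j \<in> letters
    \<and> x = Fword q v (q i) \<and> x = Fword q w (q j)"
    using assms
  proof (induction m)
    case 0
    then show ?case by simp
  next
    case (Suc m)
    show ?case
    proof (cases "x \<in> V q m")
      case True
      then obtain v w i j where *: "v \<in> words m" "w \<in> words m" "v \<noteq> w" "i \<in> letters" "j \<in> letters"
        "x = Fword q v (q i)" "x = Fword q w (q j)"
        using Suc by blast
      then have "v @ [i] \<in> words (Suc m)" "w @ [j] \<in> words (Suc m)" "v @ [i] \<noteq> w @ [j]"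
        "x = Fword q (v @ [i]) (q i)" "x = Fword q (w @ [j]) (q j)"
        by (auto intro: words_snoc simp: Fword_append F_fixed)
      then show ?thesis using * by blast
    next
      case False
      obtain t k where t: "t \<in> words (Suc m)" "k \<in> letters" "x = Fword q t (q k)"
        using Suc.prems(1) unfolding V_eq_words by blast
      have "t \<noteq> []" using t(1) by (auto simp: words_letters)
      then obtain w i where w: "t = w @ [i]" by (metis rev_exhaust)
      then have wi: "w \<in> words m" "i \<in> letters" using t(1) by (auto simp: words_letters)
      have "i \<noteq> k"
      proof
        assume "i = k"
        then have "x = Fword q w (q k)" using t(3) w by (simp add: Fword_append F_fixed)
        then show False using False wi t(2) unfolding V_eq_words by blast
      qed
      then have "w @ [k] \<in> words (Suc m)" "w @ [i] \<noteq> w @ [k]" "x = Fword q (w @ [k]) (q i)"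
        using wi t words_snoc w by (auto simp: Fword_append F_swap)
      then show ?thesis using t w wi by blast
    qed
  qed
  then show thesis using that by blast
qed

end

section \<open>Spectral decimation\<close>
lemma letters_split:
  assumes "i \<in> letters"
  obtains j k where "letters = {i, j, k}" "i \<noteq> j" "i \<noteq> k" "j \<noteq> k"
proof -
  have "letters = {0, 1, 2}" "letters = {1, 0, 2}" "letters = {2, 0, 1}"
    by (auto simp: letters_def)
  then show thesis
    using assms that[of 1 2] that[of 0 2] that[of 0 1] by (auto simp: letters_def)
qed

text \<open>
  The \<open>a\<close>'s are the values at the corners of a cell, \<open>b0\<close>, \<open>b1\<close>, \<open>b2\<close> those at the midpoints
  opposite to them, and the \<open>d\<close>'s are the errors in the eigenvalue equations at the
  midpoints. Adding the three equations determines the sum of the \<open>b\<close>'s, and then each \<open>b\<close>; what is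
  needed is the contribution \<open>b1 + b2 - 2 * a0\<close> of the small cell at a corner in terms of the
  contribution \<open>a1 + a2 - 2 * a0\<close> of the large one.
\<close>
lemma midpoint_elimination:
  fixes a0 a1 a2 b0 b1 b2 d0 d1 d2 t :: real
  assumes "a1 + a2 + b1 + b2 - 4 * b0 = - t * b0 + d0"
    and "a2 + a0 + b2 + b0 - 4 * b1 = - t * b1 + d1"
    and "a0 + a1 + b0 + b1 - 4 * b2 = - t * b2 + d2"
  shows "(2 - t) * (5 - t) * (b1 + b2 - 2 * a0) - (6 - t) * (a1 + a2 - 2 * a0) - 2 * t * (5 - t) * a0
    = - (2 * (d0 + d1 + d2) + (2 - t) * (d1 + d2))"
proof -
  have 1: "(2 - t) * (b0 + b1 + b2) = 2 * (a0 + a1 + a2) - (d0 + d1 + d2)"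
    using assms by (simp add: algebra_simps)
  have 2: "(5 - t) * (b1 + b2) = 2 * a0 + a1 + a2 + 2 * (b0 + b1 + b2) - d1 - d2"
    using assms by (simp add: algebra_simps)
  have "(2 - t) * ((5 - t) * (b1 + b2)) = (2 - t) * (2 * a0 + a1 + a2 - d1 - d2)
      + 2 * ((2 - t) * (b0 + b1 + b2))"
    unfolding 2 by (simp add: algebra_simps)
  also have "\<dots> = (2 - t) * (2 * a0 + a1 + a2 - d1 - d2)
      + 2 * (2 * (a0 + a1 + a2) - (d0 + d1 + d2))" unfolding 1 ..
  finally show ?thesis by (simp add: algebra_simps)
qed

context gasket
begin

text \<open>
  The midpoint of an edge of a cell is not in \<open>V_0\<close>, because it lies in two cells of the next
  level. Its neighbours are the ends of the edge and the other two midpoints of the cell.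
\<close>
lemma edge_midpoint:
  assumes w: "w \<in> words m" and ijk: "letters = {i, j, k}" "i \<noteq> j" "i \<noteq> k" "j \<noteq> k"
  shows "Fword q (w @ [i]) (q j) \<in> V q (Suc m) - V q 0"
    and "graph_laplacian q (Suc m) u (Fword q (w @ [i]) (q j)) =
      u (Fword q w (q i)) + u (Fword q w (q j)) + u (Fword q (w @ [j]) (q k))
      + u (Fword q (w @ [i]) (q k)) - 4 * u (Fword q (w @ [i]) (q j))"
proof -
  have l: "i \<in> letters" "j \<in> letters" "k \<in> letters" using ijk by auto
  then have wij: "w @ [i] \<in> words (Suc m)" "w @ [j] \<in> words (Suc m)" "w @ [i] \<noteq> w @ [j]"
    using w ijk words_snoc by auto
  have swap: "Fword q (w @ [i]) (q j) = Fword q (w @ [j]) (q i)"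
    by (simp add: Fword_append F_swap)
  have "Fword q (w @ [i]) (q j) \<noteq> q n" if n: "n \<in> letters" for n
  proof
    assume e: "Fword q (w @ [i]) (q j) = q n"
    have "q n \<in> Fword q (w @ [i]) ` solid_triangle q"
      using e vertex_in_solid_triangle[OF l(2)] by (metis imageI)
    moreover have "q n \<in> Fword q (w @ [j]) ` solid_triangle q"
      using e swap vertex_in_solid_triangle[OF l(1)] by (metis imageI)
    ultimately show False using cell_corner_word[OF wij(1,2) n] wij(3) by blast
  qed
  moreover have "Fword q (w @ [i]) (q j) \<in> V q (Suc m)"
    unfolding V_eq_words using wij l by blast
  ultimately show "Fword q (w @ [i]) (q j) \<in> V q (Suc m) - V q 0"
    unfolding V_0 by blast
  have "graph_laplacian q (Suc m) u (Fword q (w @ [i]) (q j))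
      = cell_diff u (w @ [i]) j + cell_diff u (w @ [j]) i"
    using graph_laplacian_two_cells[OF wij l(2,1) refl swap] .
  then show "graph_laplacian q (Suc m) u (Fword q (w @ [i]) (q j)) =
      u (Fword q w (q i)) + u (Fword q w (q j)) + u (Fword q (w @ [j]) (q k))
      + u (Fword q (w @ [i]) (q k)) - 4 * u (Fword q (w @ [i]) (q j))"
    unfolding cell_diff_def ijk(1) using ijk(2-)
    by (simp add: Fword_append F_fixed F_swap[of q j i])
qed

text \<open>
  The bound collects the errors of \<open>midpoint_elimination\<close>:
  \<open>2 * 3 * e + (2 - t) * 2 * e = (10 - 2 * t) * e\<close>.
\<close>
lemma corner_decimation:
  assumes w: "w \<in> words m" and i: "i \<in> letters" and t: "t < 0"
    and approx: "\<And>x. x \<in> V q (Suc m) - V q 0 \<Longrightarrow> \<bar>graph_laplacian q (Suc m) u x + t * u x\<bar> \<le> e"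
  shows "\<bar>(2 - t) * (5 - t) * cell_diff u (w @ [i]) i - (6 - t) * cell_diff u w i
    - 2 * t * (5 - t) * u (Fword q w (q i))\<bar> \<le> (10 - 2 * t) * e"
proof -
  obtain j k where ijk: "letters = {i, j, k}" "i \<noteq> j" "i \<noteq> k" "j \<noteq> k"
    using letters_split[OF i] by metis
  then have perm: "letters = {j, k, i}" "letters = {i, k, j}" "k \<noteq> i" "k \<noteq> j" "j \<noteq> i" by auto
  define a where "a l = u (Fword q w (q l))" for l
  define b0 b1 b2 where "b0 = u (Fword q (w @ [j]) (q k))" and "b1 = u (Fword q (w @ [i]) (q k))"
    and "b2 = u (Fword q (w @ [i]) (q j))"
  have swaps: "Fword q (w @ [l]) (q n) = Fword q (w @ [n]) (q l)" for l n
    by (simp add: Fword_append F_swap)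
  define d where "d x = graph_laplacian q (Suc m) u x + t * u x" for x
  define d0 d1 d2 where "d0 = d (Fword q (w @ [j]) (q k))" and "d1 = d (Fword q (w @ [i]) (q k))"
    and "d2 = d (Fword q (w @ [i]) (q j))"
  note mid0 = edge_midpoint[OF w perm(1) ijk(4) perm(5,3)]
  note mid1 = edge_midpoint[OF w perm(2) ijk(3,2) perm(4)]
  note mid2 = edge_midpoint[OF w ijk]
  have small: "\<bar>d0\<bar> \<le> e" "\<bar>d1\<bar> \<le> e" "\<bar>d2\<bar> \<le> e"
    unfolding d0_def d1_def d2_def d_def using approx mid0(1) mid1(1) mid2(1) by blast+
  have "a j + a k + b1 + b2 - 4 * b0 = - t * b0 + d0"
    "a k + a i + b2 + b0 - 4 * b1 = - t * b1 + d1"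
    "a i + a j + b0 + b1 - 4 * b2 = - t * b2 + d2"
    unfolding d0_def d1_def d2_def d_def mid0(2) mid1(2) mid2(2) a_def b0_def b1_def b2_def
    by (simp_all add: swaps[of k i] swaps[of j i] swaps[of k j])
  note elim = midpoint_elimination[OF this]
  have fine: "cell_diff u (w @ [i]) i = b1 + b2 - 2 * a i"
    unfolding cell_diff_def ijk(1) b1_def b2_def a_def using ijk(2-)
    by (simp add: Fword_append F_fixed)
  have coarse: "cell_diff u w i = a j + a k - 2 * a i"
    unfolding cell_diff_def ijk(1) a_def using ijk(2-) by simp
  have "\<bar>(2 - t) * (d1 + d2)\<bar> \<le> (2 - t) * (2 * e)"
    unfolding abs_mult using t small by (intro mult_mono) auto
  moreover have "\<bar>- (2 * (d0 + d1 + d2) + z)\<bar> \<le> 2 * (3 * e) + y" if "\<bar>z\<bar> \<le> y" for z y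
    using that small by argo
  ultimately have "\<bar>- (2 * (d0 + d1 + d2) + (2 - t) * (d1 + d2))\<bar> \<le> 2 * (3 * e) + (2 - t) * (2 * e)"
    by blast
  also have "\<dots> = (10 - 2 * t) * e" by (simp add: algebra_simps)
  finally show ?thesis unfolding fine coarse a_def[of i, symmetric] elim .
qed

text \<open>
  Adding \<open>corner_decimation\<close> over the two cells at \<open>x\<close>, \<open>6 - t\<close> times the error at the coarse
  level is at most \<open>((2 - t) * (5 - t) + 2 * (10 - 2 * t)) * e\<close>, and this coefficient
  factors as \<open>(6 - t) * (5 - t)\<close>. The constant \<open>5 - t\<close> is sharp enough for \<open>decimation\<close>, since \<open>t\<close>
  and \<open>t * (5 - t)\<close> are the eigenvalue parameters of the two levels.
\<close>
lemma decimation_step: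
  assumes t: "t < 0"
    and approx: "\<And>x. x \<in> V q (Suc m) - V q 0 \<Longrightarrow> \<bar>graph_laplacian q (Suc m) u x + t * u x\<bar> \<le> e"
    and x: "x \<in> V q m - V q 0"
  shows "\<bar>graph_laplacian q m u x + t * (5 - t) * u x\<bar> \<le> (5 - t) * e"
proof -
  obtain v w i j where vw: "v \<in> words m" "w \<in> words m" "v \<noteq> w" "i \<in> letters" "j \<in> letters"
    "x = Fword q v (q i)" "x = Fword q w (q j)"
    using interior_vertex_two_cells x by blast
  have lap: "graph_laplacian q m u x = cell_diff u v i + cell_diff u w j"
    using graph_laplacian_two_cells[OF vw] .
  have lap': "graph_laplacian q (Suc m) u x = cell_diff u (v @ [i]) i + cell_diff u (w @ [j]) j"
  proof (rule graph_laplacian_two_cells)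
    show "v @ [i] \<in> words (Suc m)" "w @ [j] \<in> words (Suc m)" "v @ [i] \<noteq> w @ [j]"
      using vw words_snoc by auto
    show "x = Fword q (v @ [i]) (q i)" "x = Fword q (w @ [j]) (q j)"
      using vw(6,7) by (simp_all add: Fword_append F_fixed)
  qed (fact vw)+
  define r where "r z l = (2 - t) * (5 - t) * cell_diff u (z @ [l]) l - (6 - t) * cell_diff u z l
    - 2 * t * (5 - t) * u (Fword q z (q l))" for z l
  define D where "D = graph_laplacian q (Suc m) u x + t * u x"
  have r: "\<bar>r v i\<bar> \<le> (10 - 2 * t) * e" "\<bar>r w j\<bar> \<le> (10 - 2 * t) * e"
    unfolding r_def using corner_decimation[OF _ _ t approx] vw by blast+
  have "V q m \<subseteq> V q (Suc m)" by (rule V_mono_Suc)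
  then have "\<bar>D\<bar> \<le> e" unfolding D_def using approx x by blast
  then have "\<bar>(2 - t) * (5 - t) * D\<bar> \<le> (2 - t) * (5 - t) * e"
    using t by (auto simp: abs_mult intro!: mult_left_mono)
  moreover have "(6 - t) * (graph_laplacian q m u x + t * (5 - t) * u x)
      = (2 - t) * (5 - t) * D - r v i - r w j"
    unfolding lap D_def lap' r_def vw(6,7)[symmetric] by (simp add: algebra_simps)
  ultimately have "\<bar>(6 - t) * (graph_laplacian q m u x + t * (5 - t) * u x)\<bar>
      \<le> (2 - t) * (5 - t) * e + 2 * ((10 - 2 * t) * e)"
    using r by linarith
  also have "\<dots> = (6 - t) * ((5 - t) * e)" by (simp add: algebra_simps)
  finally show ?thesis using t by (simp add: abs_mult)
qed

text \<open>
  A continuous eigenfunction restricts to an exact eigenfunction on every graph approximation.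
  The sequence \<open>g\<close> is the backward orbit of the decimation map that is selected by its
  renormalised limit; negative parameters never meet the exceptional values \<open>2\<close>, \<open>5\<close>, \<open>6\<close>
  at which the elimination breaks down.
\<close>
lemma decimation:
  assumes neg: "\<And>m. g m < 0" and rec: "\<And>m. g m = g (Suc m) * (5 - g (Suc m))"
    and lim: "(\<lambda>m. 3/2 * 5^m * g m) \<longlonglongrightarrow> - \<mu>" and \<mu>: "\<mu> > 0"
    and lap: "has_laplacian q u f" and f: "\<And>x. x \<in> SG q \<Longrightarrow> f x = \<mu> * u x"
    and x: "x \<in> V q m - V q 0"
  shows "graph_laplacian q m u x = - g m * u x"
proof -
  define defect where "defect n y = graph_laplacian q n u y + g n * u y" for n y
  \<comment> \<open>An error bound proportional to \<open>g\<close> passes from level \<open>n + k\<close> down to level \<open>n\<close> with the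
    same constant \<open>r\<close>.\<close>
  have down: "\<bar>defect n y\<bar> \<le> r * (- g n)" if "y \<in> V q n - V q 0"
    "\<And>y. y \<in> V q (n + k) - V q 0 \<Longrightarrow> \<bar>defect (n + k) y\<bar> \<le> r * (- g (n + k))" for n k r y
    using that
  proof (induction k arbitrary: y)
    case 0
    then show ?case by simp
  next
    case (Suc k)
    have "\<bar>defect (n + k) z\<bar> \<le> r * (- g (n + k))" if "z \<in> V q (n + k) - V q 0" for z
      using decimation_step[OF neg[of "Suc (n + k)"] _ that, of u "r * (- g (n + Suc k))"] Suc.prems(2)
      unfolding defect_def rec[of "n + k"] by (simp add: algebra_simps)
    then show ?case using Suc.IH Suc.prems(1) by blast
  qed
  obtain M where M: "M > 0" "\<And>y. y \<in> SG q \<Longrightarrow> \<bar>u y\<bar> \<le> M"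
  proof -
    have "bounded (u ` SG q)"
      using lap compact_SG unfolding has_laplacian_def
      by (auto intro!: compact_imp_bounded compact_continuous_image)
    then show thesis using that unfolding bounded_pos by auto
  qed
  \<comment> \<open>Every constant \<open>r\<close> works at sufficiently fine levels, because \<open>5^n * g n\<close> stays away
    from \<open>0\<close> while \<open>5^n\<close> times the defect tends to \<open>0\<close> uniformly.\<close>
  have "\<bar>defect m x\<bar> \<le> r * (- g m)" if r: "r > 0" for r
  proof -
    define e where "e = r * \<mu> / 4"
    have e: "e > 0" using r \<mu> by (simp add: e_def)
    obtain N1 where N1: "\<And>n y. n \<ge> N1 \<Longrightarrow> y \<in> V q n - V q 0 \<Longrightarrow>
        \<bar>3/2 * 5^n * graph_laplacian q n u y - f y\<bar> < e"
      using lap e unfolding has_laplacian_def by blast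
    have "\<exists>N. \<forall>n\<ge>N. norm (3/2 * 5^n * g n - - \<mu>) < min (\<mu> / 2) (e / M)"
      using lim \<mu> e M(1) by (intro LIMSEQ_D) auto
    then obtain N2 where N2: "\<And>n. n \<ge> N2 \<Longrightarrow> \<bar>3/2 * 5^n * g n + \<mu>\<bar> < min (\<mu> / 2) (e / M)"
      by auto
    define n where "n = max m (max N1 N2)"
    have n: "n \<ge> N1" "n \<ge> N2" "n = m + (n - m)" by (auto simp: n_def)
    have "\<bar>defect n y\<bar> \<le> r * (- g n)" if y: "y \<in> V q n - V q 0" for y
    proof -
      define c :: real where "c = 3/2 * 5^n"
      have c: "c > 0" by (simp add: c_def)
      have ySG: "y \<in> SG q" using y V_SG by blast
      have A: "\<bar>c * graph_laplacian q n u y - \<mu> * u y\<bar> < e"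
        using N1[OF n(1) y] f[OF ySG] by (simp add: c_def)
      have B: "\<bar>c * g n + \<mu>\<bar> < \<mu> / 2" "\<bar>c * g n + \<mu>\<bar> < e / M"
        using N2[OF n(2)] by (simp_all add: c_def)
      have "\<bar>(c * g n + \<mu>) * u y\<bar> \<le> e / M * M"
        unfolding abs_mult using B(2) M(2)[OF ySG] M(1) e by (intro mult_mono) auto
      then have B2: "\<bar>(c * g n + \<mu>) * u y\<bar> \<le> e" using M(1) by simp
      have "c * defect n y = (c * graph_laplacian q n u y - \<mu> * u y) + (c * g n + \<mu>) * u y"
        unfolding defect_def by (simp add: algebra_simps)
      then have "\<bar>c * defect n y\<bar> \<le> 2 * e" using A B2 by linarith
      also have "\<dots> = r * (\<mu> / 2)" by (simp add: e_def)
      also have "\<dots> \<le> r * (c * (- g n))"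
        using B(1) r by (intro mult_left_mono) (simp_all only: abs_less_iff, linarith+)
      finally have "c * \<bar>defect n y\<bar> \<le> c * (r * (- g n))" using c by (simp add: abs_mult mult_ac)
      then show ?thesis using c mult_le_cancel_left_pos by blast
    qed
    then show ?thesis using down[OF x, of "n - m" r] n(3) by metis
  qed
  note small = this
  have "\<bar>defect m x\<bar> \<le> 0"
  proof (rule field_le_epsilon)
    fix e :: real assume "e > 0"
    then have "e / (- g m) > 0" using neg[of m] by (simp add: divide_pos_neg)
    from small[OF this] show "\<bar>defect m x\<bar> \<le> 0 + e" using neg[of m] by simp
  qed
  then show ?thesis unfolding defect_def by simp
qed

end

section \<open>Solutions on the blow-up at the points \<open>x_n\<close>\<close>
lemma F0pow_eq: "F0pow q n x = q 0 + 2 powi (- n) *\<^sub>R (x - q 0)"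
proof (cases "n \<ge> 0")
  case True
  have "F q 0 (q 0 + c *\<^sub>R y) = q 0 + (1 / 2 * c) *\<^sub>R y" for c y
    by (simp add: F_def vec_eq_iff field_simps)
  then have "(F q 0 ^^ k) x = q 0 + (1 / 2) ^ k *\<^sub>R (x - q 0)" for k
    by (induction k) simp_all
  then show ?thesis
    using True by (simp add: F0pow_def power_int_def power_one_over inverse_eq_divide)
next
  case False
  have "F q 0 (2 *\<^sub>R y - q 0) = y" for y
    by (simp add: F_def)
  then have inv0: "inv (F q 0) y = 2 *\<^sub>R y - q 0" for y
    by (intro inv_f_eq) (auto simp: inj_def F_inject)
  have "inv (F q 0) (q 0 + c *\<^sub>R y) = q 0 + (2 * c) *\<^sub>R y" for c y
    unfolding inv0 by (simp add: vec_eq_iff field_simps)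
  then have "(inv (F q 0) ^^ k) x = q 0 + 2 ^ k *\<^sub>R (x - q 0)" for k
    by (induction k) simp_all
  then show ?thesis
    using False by (simp add: F0pow_def power_int_def)
qed

lemma F0pow_F0pow: "F0pow q a (F0pow q b x) = F0pow q (a + b) x"
  by (simp add: F0pow_eq power_int_add[symmetric])

lemma F0pow_fixed: "F0pow q n (q 0) = q 0"
  by (simp add: F0pow_eq)

lemma rho0_F0pow: "rho0 q (F0pow q n x) = F0pow q n (rho0 q x)"
  by (simp add: F0pow_eq rho0_def algebra_simps)

lemma Fword_replicate_0: "Fword q (replicate k 0) x = F0pow q (int k) x"
proof -
  have "Fword q (replicate k 0) x = (F q 0 ^^ k) x" by (induction k) auto
  then show ?thesis by (simp add: F0pow_def)
qed

lemma decimation_seq_neg: "decimation_seq lam l \<Longrightarrow> l n < 0"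
  and decimation_seq_rec: "decimation_seq lam l \<Longrightarrow> l (n - 1) = l n * (5 - l n)"
  by (auto simp: decimation_seq_def)

context gasket
begin

lemma F0pow_SG:
  assumes "x \<in> SG q" shows "F0pow q (int k) x \<in> SG q"
proof -
  have "(F q 0 ^^ k) x \<in> SG q" using assms by (induction k) (auto intro: F_SG)
  then show ?thesis by (simp add: F0pow_def)
qed

lemma F0pow_SGinf:
  assumes "x \<in> SG q" shows "F0pow q n x \<in> SGinf q"
proof -
  define N where "N = nat \<bar>n\<bar> + 1"
  define k where "k = nat (n + int N)"
  have "F0pow q n x = F0pow q (- int N) (F0pow q (int k) x)"
  proof -
    have "int k = n + int N" unfolding k_def N_def by simp
    then show ?thesis unfolding F0pow_F0pow by simp
  qed
  moreover have "F0pow q (int k) x \<in> SG q" using F0pow_SG assms .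
  moreover have "N \<in> {1..}" by (simp add: N_def)
  ultimately show ?thesis unfolding SGinf_def by blast
qed

lemma even_xpt:
  assumes "even_rho0 q u"
  shows "u (F0pow q n (q 2)) = u (xpt q n)"
proof -
  have "xpt q n \<in> SGinf q" unfolding xpt_def by (intro F0pow_SGinf vertex_SG) simp
  then have "u (rho0 q (xpt q n)) = u (xpt q n)"
    using assms unfolding even_rho0_def by blast
  then show ?thesis
    unfolding xpt_def rho0_F0pow rho0_swaps(1)[OF equilateral] .
qed

text \<open>
  Magnifying by \<open>2^N\<close> multiplies the eigenvalue by \<open>5^N\<close>, which amounts to a shift of the sequence
  \<open>l\<close> by \<open>N\<close>.
\<close>
lemma blow_up_graph_equation:
  assumes lam: "lam > 0" and l: "decimation_seq lam l" and u: "solves_inf q lam u"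
    and x: "x \<in> V q m - V q 0"
  shows "graph_laplacian q m (u \<circ> F0pow q (- int N)) x
    = - l (int m - int N) * (u \<circ> F0pow q (- int N)) x"
proof -
  obtain f where f: "has_laplacian_inf q u f" "\<And>x. x \<in> SGinf q \<Longrightarrow> f x = lam * u x"
    using u unfolding solves_inf_def by auto
  show ?thesis
  proof (rule decimation[where \<mu> = "5 ^ N * lam"])
    show "l (int m - int N) < 0" for m using l unfolding decimation_seq_def by blast
    show "l (int m - int N) = l (int (Suc m) - int N) * (5 - l (int (Suc m) - int N))" for m
    proof -
      have "int m - int N = int (Suc m) - int N - 1" by simp
      then show ?thesis using decimation_seq_rec[OF l, of "int (Suc m) - int N"] by (simp only:)
    qed
    have "(\<lambda>m. 5 ^ N * (3/2 * 5 ^ m * l (int m))) \<longlonglongrightarrow> 5 ^ N * - lam"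
      using l unfolding decimation_seq_def by (intro tendsto_mult_left) blast
    then have "(\<lambda>m. 3/2 * 5 ^ (m + N) * l (int (m + N) - int N)) \<longlonglongrightarrow> - (5 ^ N * lam)"
      by (simp add: power_add mult_ac)
    then show "(\<lambda>m. 3/2 * 5 ^ m * l (int m - int N)) \<longlonglongrightarrow> - (5 ^ N * lam)"
      by (rule LIMSEQ_offset)
    show "has_laplacian q (u \<circ> F0pow q (- int N)) (\<lambda>x. 5 ^ N * f (F0pow q (- int N) x))"
      using f(1) unfolding has_laplacian_inf_def by blast
    show "5 ^ N * f (F0pow q (- int N) x) = 5 ^ N * lam * (u \<circ> F0pow q (- int N)) x"
      if "x \<in> SG q" for x
      using f(2)[OF F0pow_SGinf[OF that]] by simp
  qed (use lam x in auto)
qed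

text \<open>
  The cell with corners \<open>q 0\<close>, \<open>x_(n-1)\<close> and the mirror image of \<open>x_(n-1)\<close> has as midpoints
  \<open>x_n\<close>, its mirror image, and the midpoint of the edge opposite to \<open>q 0\<close>. Eliminating the value
  \<open>z\<close> at the latter from the equations at \<open>x_n\<close> and at this midpoint leaves the recursion.
\<close>
lemma xpt_recursion:
  assumes lam: "lam > 0" and l: "decimation_seq lam l"
    and u: "solves_inf q lam u" and even: "even_rho0 q u"
  shows "(6 - l n) * u (xpt q (n - 1))
    = (2 - l n) * (5 - l n) * u (xpt q n) - (4 - l n) * u (q 0)"
proof -
  \<comment> \<open>The cell is \<open>F_0^k (SG)\<close>, magnified by \<open>2^N\<close>; truncated subtraction makes one
    of \<open>k\<close> and \<open>N\<close> zero, and \<open>k - N = n - 1\<close> in either case.\<close>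
  define k where "k = nat (n - 1)"
  define N where "N = nat (1 - n)"
  have kN: "int k - int N = n - 1" by (auto simp: k_def N_def)
  define w where "w = replicate k (0 :: nat)"
  have w: "w \<in> words k" by (auto simp: w_def words_letters)
  define v where "v = u \<circ> F0pow q (- int N)"
  define t where "t = l n"
  have eq: "graph_laplacian q (Suc k) v x = - t * v x" if "x \<in> V q (Suc k) - V q 0" for x
  proof -
    have "int (Suc k) - int N = n" using kN by simp
    then show ?thesis using blow_up_graph_equation[OF lam l u that] unfolding v_def t_def by metis
  qed
  have v0: "v (Fword q w (q 0)) = u (q 0)"
    by (simp add: w_def v_def Fword_replicate_0 F0pow_fixed)
  have v_corner: "v (Fword q w x) = u (F0pow q (n - 1) x)" for x
  proof -
    have "- int N + int k = n - 1" using kN by simp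
    then show ?thesis by (simp only: w_def v_def Fword_replicate_0 F0pow_F0pow o_apply)
  qed
  have v_mid: "v (Fword q (w @ [0]) x) = u (F0pow q n x)" for x
  proof -
    have "w @ [0] = replicate (Suc k) 0" by (simp add: w_def replicate_append_same)
    then have "v (Fword q (w @ [0]) x) = u (F0pow q (- int N + int (Suc k)) x)"
      by (simp only: v_def Fword_replicate_0 F0pow_F0pow o_apply)
    also have "- int N + int (Suc k) = n" using kN by simp
    finally show ?thesis .
  qed
  define z where "z = v (Fword q (w @ [1]) (q 2))"
  define c c' where "c = u (xpt q n)" and "c' = u (xpt q (n - 1))"
  have corner: "v (Fword q w (q 1)) = c'" "v (Fword q w (q 2)) = c'"
    unfolding v_corner c'_def even_xpt[OF even] by (simp_all add: xpt_def)
  have mid: "v (Fword q (w @ [0]) (q 1)) = c" "v (Fword q (w @ [0]) (q 2)) = c"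
    unfolding v_mid c_def even_xpt[OF even] by (simp_all add: xpt_def)
  have swap: "Fword q (w @ [i]) (q j) = Fword q (w @ [j]) (q i)" for i j
    by (simp add: Fword_append F_swap)
  have L: "letters = {0, 1, 2}" "letters = {1, 2, 0}" by (auto simp: letters_def)
  have "- t * c = u (q 0) + c' + z + c - 4 * c"
    using eq[OF edge_midpoint(1)[OF w L(1)]] edge_midpoint(2)[OF w L(1), of v]
    unfolding v0 mid corner z_def by simp
  moreover have "- t * z = c' + c' + c + c - 4 * z"
    using eq[OF edge_midpoint(1)[OF w L(2)]] edge_midpoint(2)[OF w L(2), of v]
      swap[of 2 0] swap[of 1 0] mid
    unfolding corner z_def by simp
  ultimately have 1: "z = (3 - t) * c - u (q 0) - c'" and 2: "(4 - t) * z = 2 * c + 2 * c'"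
    by (simp_all add: algebra_simps)
  from 2 have "(6 - t) * c' = (2 - t) * (5 - t) * c - (4 - t) * u (q 0)"
    unfolding 1 by (simp add: algebra_simps)
  then show ?thesis unfolding c_def c'_def t_def .
qed

text \<open>
  The deviation \<open>d\<close> from \<open>1 - l n / 4\<close> satisfies the homogeneous recursion. The zero
  normal derivative forces \<open>(5/3)^n * d n\<close> to tend to \<open>0\<close>, whereas a nonzero solution of the
  homogeneous recursion behaves like a multiple of \<open>(3/5)^n\<close>.
  The comparison of the two is made by the increasing sequence \<open>h\<close>.
\<close>
lemma cosine_at_xpt:
  assumes lam: "lam > 0" and l: "decimation_seq lam l"
    and C: "solves_inf q lam C" "even_rho0 q C" "C (q 0) = 1" "has_normal_deriv q C 0"
  shows "C (xpt q n) = 1 - l n / 4"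
proof -
  note neg = decimation_seq_neg[OF l] and rec = decimation_seq_rec[OF l]
  have scaled: "(\<lambda>m. 3/2 * 5 ^ m * l (int m)) \<longlonglongrightarrow> - lam"
    using l unfolding decimation_seq_def by blast
  define d where "d n = C (xpt q n) - (1 - l n / 4)" for n
  have d_rec: "(6 - l n) * d (n - 1) = (2 - l n) * (5 - l n) * d n" for n
  proof -
    have "(6 - l n) * (1 - l n * (5 - l n) / 4) = (2 - l n) * (5 - l n) * (1 - l n / 4) - (4 - l n)"
      by (simp add: field_simps)
    then show ?thesis
      using xpt_recursion[OF lam l C(1,2), of n] unfolding d_def rec C(3) right_diff_distrib[of _ "C _"]
      by simp
  qed
  have d_lim: "(\<lambda>m. (5/3) ^ m * d (int m)) \<longlonglongrightarrow> 0"
  proof -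
    have "(\<lambda>m. (5/3) ^ m * (2 * C (q 0) - C ((F q 0 ^^ m) (q 1)) - C ((F q 0 ^^ m) (q 2)))) \<longlonglongrightarrow> 0"
      using C(4) unfolding has_normal_deriv_def .
    moreover have "(F q 0 ^^ m) (q 1) = xpt q (int m)" "(F q 0 ^^ m) (q 2) = F0pow q (int m) (q 2)" for m
      by (simp_all add: xpt_def F0pow_def)
    ultimately have 1: "(\<lambda>m. (5/3) ^ m * (2 - 2 * C (xpt q (int m)))) \<longlonglongrightarrow> 0"
      by (simp add: even_xpt[OF C(2)] C(3) algebra_simps)
    have "(\<lambda>m. (1/3) ^ m * (3/2 * 5 ^ m * l (int m))) \<longlonglongrightarrow> 0 * - lam"
      by (intro tendsto_mult scaled LIMSEQ_realpow_zero) auto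
    then have 2: "(\<lambda>m. (5/3) ^ m * l (int m) * (3/2)) \<longlonglongrightarrow> 0"
      by (simp add: power_divide mult_ac)
    have "(\<lambda>m. - 1/2 * ((5/3) ^ m * (2 - 2 * C (xpt q (int m))))
        + 1/6 * ((5/3) ^ m * l (int m) * (3/2))) \<longlonglongrightarrow> - 1/2 * 0 + 1/6 * 0"
      by (intro tendsto_add tendsto_mult_left 1 2)
    then show ?thesis by (simp add: d_def algebra_simps)
  qed
  \<comment> \<open>Here \<open>3^m * (- l m)\<close> is comparable to \<open>(3/5)^m\<close>. The factor \<open>1 - l m\<close>, which tends to
    \<open>1\<close>, is added to make \<open>h\<close> increasing.\<close>
  define h where "h m = \<bar>d (int m)\<bar> / (3 ^ m * (- l (int m)) * (1 - l (int m)))" for m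
  have h_mono: "h m \<le> h (Suc m)" for m
  proof -
    define t where "t = - l (int (Suc m))"
    define y where "y = \<bar>d (int (Suc m))\<bar>"
    have t: "t > 0" using neg by (simp add: t_def)
    have lm: "l (int m) = - t * (5 + t)"
      using rec[of "int (Suc m)"] by (simp add: t_def)
    have "(6 + t) * d (int m) = (2 + t) * (5 + t) * d (int (Suc m))"
      using d_rec[of "int (Suc m)"] by (simp add: t_def)
    then have "\<bar>(6 + t) * d (int m)\<bar> = \<bar>(2 + t) * (5 + t) * d (int (Suc m))\<bar>" by (rule arg_cong)
    then have dm: "\<bar>d (int m)\<bar> = (2 + t) * (5 + t) * y / (6 + t)"
      using t unfolding abs_mult y_def[symmetric] by (simp add: eq_divide_eq mult.commute)
    have "3 * (2 + t) * (1 + t) \<le> (6 + t) * (1 + t * (5 + t))"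
      using t by (simp add: algebra_simps)
    then have "3 * (2 + t) * (1 + t) * y \<le> y * ((6 + t) * (1 + t * (5 + t)))"
      using mult_right_mono[of "3 * (2 + t) * (1 + t)" "(6 + t) * (1 + t * (5 + t))" y]
      by (simp add: y_def mult.commute)
    moreover have "0 < (6 + t) * (1 + t * (5 + t))"
      using t by (intro mult_pos_pos add_pos_pos) auto
    ultimately have "3 * (2 + t) * (1 + t) * y / ((6 + t) * (1 + t * (5 + t))) \<le> y"
      by (simp only: pos_divide_le_eq)
    then have "3 * (2 + t) * (1 + t) * y / ((6 + t) * (1 + t * (5 + t))) / (3 ^ Suc m * t * (1 + t))
        \<le> y / (3 ^ Suc m * t * (1 + t))"
      using t by (intro divide_right_mono) auto
    moreover have "h m = 3 * (2 + t) * (1 + t) * y / ((6 + t) * (1 + t * (5 + t))) / (3 ^ Suc m * t * (1 + t))"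
    proof -
      have nz: "6 + t \<noteq> 0" "5 + t \<noteq> 0" "1 + t \<noteq> 0" "t \<noteq> 0" "1 + t * (5 + t) \<noteq> 0"
        using t by (auto simp: add_nonneg_eq_0_iff)
      have "h m = (2 + t) * (5 + t) * y / (6 + t) / (3 ^ m * (t * (5 + t)) * (1 + t * (5 + t)))"
        unfolding h_def dm lm by simp
      then show ?thesis using nz by (simp del: distrib_left_numeral)
    qed
    moreover have "h (Suc m) = y / (3 ^ Suc m * t * (1 + t))"
      by (simp add: h_def t_def y_def)
    ultimately show ?thesis by simp
  qed
  \<comment> \<open>A nonnegative increasing sequence with limit \<open>0\<close> vanishes.\<close>
  have "h \<longlonglongrightarrow> 0"
  proof -
    have "(\<lambda>m. (1/5) ^ m * (3/2 * 5 ^ m * l (int m))) \<longlonglongrightarrow> 0 * - lam"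
      by (intro tendsto_mult scaled LIMSEQ_realpow_zero) auto
    then have "(\<lambda>m. 2/3 * ((1/5) ^ m * (3/2 * 5 ^ m * l (int m)))) \<longlonglongrightarrow> 2/3 * (0 * - lam)"
      by (rule tendsto_mult_left)
    then have l0: "(\<lambda>m. l (int m)) \<longlonglongrightarrow> 0"
      by (simp add: power_divide)
    have "(\<lambda>m. \<bar>(5/3) ^ m * d (int m)\<bar> / (- (2/3 * (3/2 * 5 ^ m * l (int m))) * (1 - l (int m))))
        \<longlonglongrightarrow> \<bar>0\<bar> / (- (2/3 * - lam) * (1 - 0))"
      using lam by (intro tendsto_divide tendsto_intros d_lim scaled l0) auto
    moreover have "\<bar>(5/3) ^ m * d (int m)\<bar> / (- (2/3 * (3/2 * 5 ^ m * l (int m))) * (1 - l (int m))) = h m" for m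
    proof -
      have "2/3 * (3/2 * 5 ^ m * l (int m)) = 5 ^ m * l (int m)" by simp
      moreover have "\<bar>(5/3) ^ m * d (int m)\<bar> = 5 ^ m * \<bar>d (int m)\<bar> / 3 ^ m"
        by (simp add: abs_mult power_divide)
      ultimately show ?thesis unfolding h_def by (simp only:) simp
    qed
    ultimately show ?thesis by simp
  qed
  then have "h m \<le> 0" for m
    using incseq_le[of h] h_mono by (simp add: incseq_SucI)
  have d_nat: "d (int m) = 0" for m
  proof -
    have c: "3 ^ m * (- l (int m)) * (1 - l (int m)) > 0"
      using neg[of "int m"] by (intro mult_pos_pos) auto
    show ?thesis using \<open>h m \<le> 0\<close> unfolding h_def pos_divide_le_eq[OF c] by simp
  qed
  \<comment> \<open>For negative indices the recursion runs in the direction of division by \<open>6 - l n > 0\<close>.\<close>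
  have "d (- int m) = 0" for m
  proof (induction m)
    case 0
    then show ?case using d_nat[of 0] by simp
  next
    case (Suc m)
    have "(6 - l (- int m)) * d (- int m - 1) = 0" using d_rec[of "- int m"] Suc by simp
    moreover have "6 - l (- int m) \<noteq> 0" using neg[of "- int m"] by simp
    moreover have "- int (Suc m) = - int m - 1" by simp
    ultimately show ?case by (simp only: mult_eq_0_iff) simp
  qed
  then have "d n = 0" using d_nat by (cases n rule: int_cases2) auto
  then show ?thesis by (simp add: d_def)
qed

end

section \<open>The infinite product and the asymptotic expansion\<close>

text \<open>
  The bound \<open>1 + 4 / m n\<close> is a supersolution of the product recursion: with \<open>t = m n\<close>,
  \<open>(1 + 4 / (2 + t)) * (1 + 4 / (t * (5 + t))) \<le> 1 + 4 / t\<close>. Telescoping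
  bounds all partial products at once, which also yields convergence.
\<close>
lemma decimation_product:
  fixes m :: "int \<Rightarrow> real"
  assumes pos: "\<And>n. m n > 0" and rec: "\<And>n. m (n - 1) = m n * (5 + m n)"
  defines "P \<equiv> \<lambda>n. \<Prod>k. 1 + 4 / (2 + m (n - int k))"
  shows "P n = (1 + 4 / (2 + m n)) * P (n - 1)" and "1 \<le> P n" and "P n \<le> 1 + 4 / m n"
proof -
  have partial: "(\<Prod>k<K. 1 + 4 / (2 + m (n - int k))) * (1 + 4 / m (n - int K)) \<le> 1 + 4 / m n" for K
  proof (induction K)
    case 0
    then show ?case by simp
  next
    case (Suc K)
    define t where "t = m (n - int K)"
    have t: "t > 0" by (simp add: t_def pos)
    have t': "m (n - int (Suc K)) = t * (5 + t)"
      using rec[of "n - int K"] by (simp add: t_def algebra_simps)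
    have "(1 + 4 / (2 + t)) * (1 + 4 / (t * (5 + t))) = (6 + t) * (t * (5 + t) + 4) / ((2 + t) * (t * (5 + t)))"
    proof -
      have "1 + 4 / (2 + t) = (6 + t) / (2 + t)" "1 + 4 / (t * (5 + t)) = (t * (5 + t) + 4) / (t * (5 + t))"
        using t by (simp_all add: add_divide_distrib[symmetric] add_divide_eq_iff add_nonneg_eq_0_iff)
      then show ?thesis by (simp only: times_divide_times_eq)
    qed
    also have "\<dots> \<le> (t + 4) * ((2 + t) * (5 + t)) / ((2 + t) * (t * (5 + t)))"
      using t by (intro divide_right_mono) (auto simp: algebra_simps)
    also have "\<dots> = 1 + 4 / t"
      using t by (simp add: divide_simps)
    finally have step: "(1 + 4 / (2 + t)) * (1 + 4 / (t * (5 + t))) \<le> 1 + 4 / t" .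
    have "(\<Prod>k<Suc K. 1 + 4 / (2 + m (n - int k))) * (1 + 4 / m (n - int (Suc K)))
      = (\<Prod>k<K. 1 + 4 / (2 + m (n - int k))) * ((1 + 4 / (2 + t)) * (1 + 4 / (t * (5 + t))))"
      unfolding t' by (simp add: t_def mult.assoc)
    also have "\<dots> \<le> (\<Prod>k<K. 1 + 4 / (2 + m (n - int k))) * (1 + 4 / t)"
      using step pos by (intro mult_left_mono prod_nonneg) (auto simp: less_imp_le add_nonneg_nonneg)
    also have "\<dots> \<le> 1 + 4 / m n" using Suc by (simp add: t_def)
    finally show ?case .
  qed
  have ge1: "1 \<le> 1 + 4 / (2 + m i)" for i using pos[of i] by simp
  have prod_nn: "0 \<le> (\<Prod>k<K. 1 + 4 / (2 + m (n - int k)))" for K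
    by (intro prod_nonneg ballI order_trans[OF zero_le_one ge1])
  have bound: "(\<Prod>k<K. 1 + 4 / (2 + m (n - int k))) \<le> 1 + 4 / m n" for K
  proof -
    have "(\<Prod>k<K. 1 + 4 / (2 + m (n - int k))) * 1
        \<le> (\<Prod>k<K. 1 + 4 / (2 + m (n - int k))) * (1 + 4 / m (n - int K))"
      using pos[of "n - int K"] prod_nn by (intro mult_left_mono) auto
    then show ?thesis using partial[of K] by linarith
  qed
  have conv: "convergent_prod (\<lambda>k. 1 + 4 / (2 + m (n - int k)))"
    using convergent_prodI_nonneg_bounded[of "\<lambda>k. 1 + 4 / (2 + m (n - int k))"] ge1 bound by blast
  show "P n \<le> 1 + 4 / m n"
    unfolding P_def using prodinf_le_const[OF conv, of 0] bound by blast
  show "1 \<le> P n"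
    unfolding P_def using prod_le_prodinf[OF convergent_prod_has_prod[OF conv], of 0]
      order_trans[OF zero_le_one ge1] ge1 by simp
  have "(\<Prod>k. 1 + 4 / (2 + m (n - int (Suc k)))) = P n / (1 + 4 / (2 + m (n - int 0)))"
    unfolding P_def using conv pos[of n]
    by (intro prodinf_split_head) (auto simp: add_nonneg_eq_0_iff add_pos_pos divide_simps)
  moreover have "n - int (Suc k) = n - 1 - int k" for k by simp
  ultimately have "P (n - 1) = P n / (1 + 4 / (2 + m n))"
    unfolding P_def by (simp only: of_nat_0 diff_zero)
  moreover have "1 + 4 / (2 + m n) \<noteq> 0" using ge1[of n] by linarith
  ultimately show "P n = (1 + 4 / (2 + m n)) * P (n - 1)" by simp
qed

text \<open>
  Since \<open>m (n - 1) \<ge> 5 * m n\<close>, growth towards \<open>- \<infinity>\<close> is at least geometric; a linear lower bound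
  is enough here.
\<close>
lemma decimation_at_bot:
  fixes m :: "int \<Rightarrow> real"
  assumes pos: "\<And>n. m n > 0" and rec: "\<And>n. m (n - 1) = m n * (5 + m n)"
  shows "filterlim m at_top at_bot"
proof -
  have grow: "m 0 * real k \<le> m (- int k)" for k
  proof (induction k)
    case 0
    then show ?case using pos[of 0] by simp
  next
    case (Suc k)
    have "- int (Suc k) = - int k - 1" by simp
    then have step: "m (- int (Suc k)) = m (- int k) * (5 + m (- int k))"
      using rec[of "- int k"] by metis
    show ?case
    proof (cases "k = 0")
      case True
      then show ?thesis using step pos[of 0] by (simp add: algebra_simps)
    next
      case False
      have "m 0 * real (Suc k) \<le> 2 * (m 0 * real k)" using False pos[of 0] by (simp add: algebra_simps)
      also have "\<dots> \<le> 2 * m (- int k)" using Suc by simp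
      also have "\<dots> \<le> m (- int (Suc k))" unfolding step using pos[of "- int k"] by (simp add: algebra_simps)
      finally show ?thesis .
    qed
  qed
  show ?thesis
    unfolding filterlim_at_top eventually_at_bot_linorder
  proof
    fix Z :: real
    define N where "N = nat \<lceil>Z / m 0\<rceil>"
    have "Z \<le> m n" if "n \<le> - int N" for n
    proof -
      have "Z / m 0 \<le> real (nat (- n))" using that unfolding N_def by linarith
      then have "Z \<le> m 0 * real (nat (- n))" using pos[of 0] by (simp add: field_simps)
      also have "\<dots> \<le> m n" using grow[of "nat (- n)"] that by simp
      finally show ?thesis .
    qed
    then show "\<exists>N. \<forall>n\<le>N. Z \<le> m n" by blast
  qed
qed

text \<open>
  In \<open>P n\<close> the product of the first two factors gives exactly the displayed main term,
  because \<open>1 - t / (2 + t) = 2 / (2 + t)\<close>. The two factors are at most \<open>3\<close>, and the remaining product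
  is \<open>1 + R\<close> with \<open>R \<le> 4 / t^4\<close>; whence the constant \<open>9 = 1/4 * 3 * 3 * 4\<close>.
\<close>
lemma difference_remainder:
  fixes m :: "int \<Rightarrow> real"
  assumes pos: "\<And>n. m n > 0" and rec: "\<And>n. m (n - 1) = m n * (5 + m n)"
  defines "P \<equiv> \<lambda>n. \<Prod>k. 1 + 4 / (2 + m (n - int k))"
  shows "\<bar>1 + m n / 4 - m n / 4 * P n
    - (2 / (2 + m n) - m n / (2 + m (n - 1)) - 4 * m n / ((2 + m n) * (2 + m (n - 1))))\<bar>
    \<le> 9 / m n ^ 3"
proof -
  define t where "t = m n"
  define s where "s = m (n - 1)"
  have t: "t > 0" and s: "s > 0" using pos by (auto simp: t_def s_def)
  have s_eq: "s = t * (5 + t)" using rec by (simp add: s_def t_def)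
  have prod: "P i = (1 + 4 / (2 + m i)) * P (i - 1)" "1 \<le> P i" "P i \<le> 1 + 4 / m i" for i
    unfolding P_def using decimation_product[of m i, OF pos rec] by blast+
  define R where "R = P (n - 2) - 1"
  have "m (n - 2) = s * (5 + s)" using rec[of "n - 1"] by (simp add: s_def)
  moreover have "t ^ 4 \<le> s * (5 + s)"
  proof -
    have "t * t \<le> s" using t by (simp add: s_eq algebra_simps)
    then have "t * t * (t * t) \<le> s * (5 + s)" using t s by (intro mult_mono) auto
    then show ?thesis by (simp add: power4_eq_xxxx mult_ac)
  qed
  ultimately have "4 / m (n - 2) \<le> 4 / t ^ 4"
    using t s pos by (intro divide_left_mono) (auto intro: mult_pos_pos)
  then have R: "0 \<le> R" "R \<le> 4 / t ^ 4"
    using prod(2,3)[of "n - 2"] unfolding R_def by auto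
  have P: "P n = (1 + 4 / (2 + t)) * ((1 + 4 / (2 + s)) * (1 + R))"
    using prod(1)[of n] prod(1)[of "n - 1"] by (simp add: t_def s_def R_def)
  have frac: "0 \<le> 4 / (2 + t)" "4 / (2 + t) \<le> 2" "0 \<le> 4 / (2 + s)" "4 / (2 + s) \<le> 2"
    using t s by (auto simp: field_simps)
  have "1 + t / 4 - t / 4 * P n - (2 / (2 + t) - t / (2 + s) - 4 * t / ((2 + t) * (2 + s)))
    = - (t / 4 * ((1 + 4 / (2 + t)) * ((1 + 4 / (2 + s)) * R)))"
  proof -
    define a b where "a = 1 / (2 + t)" and "b = 1 / (2 + s)"
    have a: "2 * a = 1 - t * a" using t by (simp add: a_def field_simps)
    have *: "2 / (2 + t) = 2 * a" "4 / (2 + t) = 4 * a" "4 / (2 + s) = 4 * b" "t / (2 + s) = t * b"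
      "4 * t / ((2 + t) * (2 + s)) = 4 * t * a * b"
      by (simp_all add: a_def b_def)
    show ?thesis unfolding P * a by (simp add: algebra_simps)
  qed
  moreover have "t / 4 * ((1 + 4 / (2 + t)) * ((1 + 4 / (2 + s)) * R)) \<le> t / 4 * (3 * (3 * (4 / t ^ 4)))"
    using t R frac by (intro mult_left_mono mult_mono mult_nonneg_nonneg) auto
  moreover have "t / 4 * (3 * (3 * (4 / t ^ 4))) = 9 / t ^ 3"
    using t by (simp add: field_simps eval_nat_numeral)
  moreover have "0 \<le> t / 4 * ((1 + 4 / (2 + t)) * ((1 + 4 / (2 + s)) * R))"
    using t R frac by (intro mult_nonneg_nonneg) auto
  ultimately show ?thesis unfolding t_def[symmetric] s_def[symmetric] by linarith
qed

theorem theorem6p5: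
  fixes q :: "nat \<Rightarrow> real^2" and lam a :: real and l :: "int \<Rightarrow> real"
    and C S E :: "real^2 \<Rightarrow> real"
  assumes "equilateral q"
    and "lam > 0"
    and "decimation_seq lam l"
    and "solves_inf q lam C" and "even_rho0 q C"
    and "C (q 0) = 1" and "has_normal_deriv q C 0"
    and "solves_inf q lam S" and "even_rho0 q S"
    and "S (q 0) = 0" and "has_normal_deriv q S a"
    and "\<And>n. S (xpt q n) = - (l n / 4) * (\<Prod>k. 1 + 4 / (2 - l (n - int k)))"
    and "\<And>x. E x = C x - S x"
  shows "(\<lambda>n. E (xpt q n)) \<in> O[at_bot](\<lambda>n. inverse (l n))
    \<and> ((\<lambda>n. l n * E (xpt q n)) \<longlongrightarrow> -1) at_bot
    \<and> ((\<lambda>n. (C (xpt q n))\<^sup>2 - (S (xpt q n))\<^sup>2) \<longlongrightarrow> 1/2) at_bot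
    \<and> (\<lambda>n. E (xpt q n) - (2 / (2 - l n) + l n / (2 - l (n - 1))
            + 4 * l n / ((2 - l n) * (2 - l (n - 1)))))
        \<in> O[at_bot](\<lambda>n. inverse (l n ^ 3))"
proof -
  interpret gasket q by standard fact
  define m where "m n = - l n" for n
  have pos: "m n > 0" and rec: "m (n - 1) = m n * (5 + m n)" for n
    using decimation_seq_neg[OF assms(3)] decimation_seq_rec[OF assms(3)] by (simp_all add: m_def)
  have lm: "l n = - m n" for n by (simp add: m_def)
  have m_top: "filterlim m at_top at_bot" using decimation_at_bot pos rec .
  have C: "C (xpt q n) = 1 + m n / 4" for n
    using cosine_at_xpt[OF assms(2-7)] by (simp add: m_def)
  define P where "P n = (\<Prod>k. 1 + 4 / (2 + m (n - int k)))" for n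
  have S: "S (xpt q n) = m n / 4 * P n" for n
    unfolding assms(12) P_def lm by simp
  define e where "e n = E (xpt q n)" for n
  define G where "G n = 2 / (2 + m n) - m n / (2 + m (n - 1)) - 4 * m n / ((2 + m n) * (2 + m (n - 1)))" for n
  have e_eq: "e n = 1 + m n / 4 - m n / 4 * P n" for n
    unfolding e_def assms(13) C S ..
  have rem: "\<bar>e n - G n\<bar> \<le> 9 / m n ^ 3" for n
    unfolding e_eq G_def P_def using difference_remainder[of m, OF pos rec] .
  have G_lim: "((\<lambda>n. m n * G n) \<longlongrightarrow> 1) at_bot"
  proof -
    have "((\<lambda>t::real. t * (2 / (2 + t) - t / (2 + t * (5 + t)) - 4 * t / ((2 + t) * (2 + t * (5 + t)))))
        \<longlongrightarrow> 1) at_top"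
      by real_asymp
    from filterlim_compose[OF this m_top] show ?thesis unfolding G_def rec .
  qed
  have rem_lim: "((\<lambda>n. m n * (e n - G n)) \<longlongrightarrow> 0) at_bot"
  proof (rule Lim_null_comparison)
    have "((\<lambda>t::real. t * (9 / t ^ 3)) \<longlongrightarrow> 0) at_top" by real_asymp
    from filterlim_compose[OF this m_top]
    show "((\<lambda>n. m n * (9 / m n ^ 3)) \<longlongrightarrow> 0) at_bot" .
    show "\<forall>\<^sub>F n in at_bot. norm (m n * (e n - G n)) \<le> m n * (9 / m n ^ 3)"
    proof (rule always_eventually, rule allI)
      fix n
      show "norm (m n * (e n - G n)) \<le> m n * (9 / m n ^ 3)"
        using mult_left_mono[OF rem, of "m n" n] pos[of n] by (simp add: abs_mult)
    qed
  qed
  have me_lim: "((\<lambda>n. m n * e n) \<longlongrightarrow> 1) at_bot"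
    using tendsto_add[OF G_lim rem_lim] by (simp add: algebra_simps)
  have e_lim: "(e \<longlongrightarrow> 0) at_bot"
  proof -
    have "((\<lambda>n. inverse (m n)) \<longlongrightarrow> 0) at_bot"
      using filterlim_compose[OF tendsto_inverse_0_at_top m_top] m_top tendsto_inverse_0_at_top by blast
    from tendsto_mult[OF me_lim this] have "((\<lambda>n. m n * e n * inverse (m n)) \<longlongrightarrow> 0) at_bot" by simp
    moreover have "m n * e n * inverse (m n) = e n" for n using pos[of n] by (simp add: field_simps)
    ultimately show ?thesis by simp
  qed
  have "(\<lambda>n. E (xpt q n)) \<in> O[at_bot](\<lambda>n. inverse (l n))"
  proof (rule bigoI_tendsto)
    have "e n / inverse (l n) = - (m n * e n)" for n by (simp add: m_def field_simps)
    then show "((\<lambda>n. E (xpt q n) / inverse (l n)) \<longlongrightarrow> - 1) at_bot"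
      using tendsto_minus[OF me_lim] by (simp add: e_def)
    show "\<forall>\<^sub>F n in at_bot. inverse (l n) \<noteq> 0"
      using pos by (intro always_eventually) (auto simp: m_def less_le)
  qed
  moreover have "((\<lambda>n. l n * E (xpt q n)) \<longlongrightarrow> -1) at_bot"
    using tendsto_minus[OF me_lim] by (simp add: lm e_def)
  moreover have "((\<lambda>n. (C (xpt q n))\<^sup>2 - (S (xpt q n))\<^sup>2) \<longlongrightarrow> 1/2) at_bot"
  proof -
    have "((\<lambda>n. 2 * e n + 1/2 * (m n * e n) - e n * e n) \<longlongrightarrow> 2 * 0 + 1/2 * 1 - 0 * 0) at_bot"
      by (intro tendsto_intros e_lim me_lim)
    moreover have "(C (xpt q n))\<^sup>2 - (S (xpt q n))\<^sup>2 = 2 * e n + 1/2 * (m n * e n) - e n * e n" for n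
      unfolding C S e_eq power2_eq_square by (simp add: algebra_simps)
    ultimately show ?thesis by simp
  qed
  moreover have "(\<lambda>n. E (xpt q n) - (2 / (2 - l n) + l n / (2 - l (n - 1))
            + 4 * l n / ((2 - l n) * (2 - l (n - 1))))) \<in> O[at_bot](\<lambda>n. inverse (l n ^ 3))"
  proof (rule bigoI[where c = 9], rule always_eventually, rule allI)
    fix n
    have "2 / (2 - l n) + l n / (2 - l (n - 1)) + 4 * l n / ((2 - l n) * (2 - l (n - 1))) = G n"
      by (simp add: lm G_def)
    then show "norm (E (xpt q n) - (2 / (2 - l n) + l n / (2 - l (n - 1))
            + 4 * l n / ((2 - l n) * (2 - l (n - 1))))) \<le> 9 * norm (inverse (l n ^ 3))"
      using rem[of n] pos[of n] by (simp add: e_def lm abs_inverse power_abs divide_inverse)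
  qed
  ultimately show ?thesis by blast
qed

end
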